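(* Let $\{G_i : i\in\mathbb{N}\}$ be a family of finite abelian groups and let $G$ be an order controllable, closed subgroup of the product $\prod_{i\in\mathbb{N}}G_i$. Then there is a family $\{y_m^{(p)} : m\in\mathbb{N},\ p\in\mathbb{P}_G\}$ of elements of $G\cap\bigoplus_{i\in\mathbb{N}}G_i$ for which the following assertions hold. (a) $\{y_m^{(p)} : m\in\mathbb{N},\ p\in\mathbb{P}_G\}$ is a generating set for $G$, and $\{y_m^{(p)} : m\in\mathbb{N}\}\subseteq \bigl(G\cap\bigoplus_{i\in\mathbb{N}}G_i\bigr)_p$ for every prime $p\in\mathbb{P}_G$. (b) If $G$ has finite exponent, then there is an isomorphic encoder $$\Phi\colon \prod_{m\in\mathbb{N},\,p\in\mathbb{P}_G}\langle y_m^{(p)}\rangle\to G$$ and, as a consequence, $G$ is weakly rectangular. (c) If $\bigoplus_{m\in\mathbb{N}}\langle y_m^{(p)}\rangle[p]$ is weakly observable (as a subgroup of $\prod_{i\in\mathbb{N}}G_i$) for each prime $p\in\mathbb{P}_G$, then $G$ is an implicit direct product.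
   Context: $\mathbb{N}=\{1,2,3,\dots\}$; groups are abelian and written additively. Each finite group $G_i$ is discrete, and $\prod_{i\in\mathbb{N}}G_i$ has the product topology. The support of $x\in\prod_i G_i$ is $\mathrm{supp}(x)=\{i : x(i)\neq 0\}$, and $\bigoplus_{i\in\mathbb{N}}G_i$ is the subgroup of elements with finite support. For $c\in\prod_i G_i$ and $J\subseteq\mathbb{N}$, $c_{|J}$ is the restriction (projection) of $c$ to the coordinates in $J$; intervals are intervals in $\mathbb{N}$. $\langle g\rangle$ is the cyclic subgroup generated by $g$. **Order controllable.** A subgroup $G\leq\prod_{i\in\mathbb{N}}G_i$ is order controllable if for every $i\in\mathbb{N}$ there is $n_i\in\mathbb{N}$ such that for each $c\in G$ there exists $c_1\in G$ with $c_{1|[1,i]}=c_{|[1,i]}$, $\mathrm{supp}(c_1)\subseteq[1,n_i]$, and $\mathrm{order}(c_1)$ divides $\mathrm{order}(c_{|[1,n_i]})$. **Weakly observable.** A subgroup $H\leq\prod_i G_i$ is weakly observable if $H\cap\bigoplus_i G_i=\overline{H}\cap\bigoplus_i G_i$, where $\overline H$ is the closure of $H$ in $\prod_i G_i$. **Generating set, isomorphic encoder, weakly rectangular, implicit direct product.** Let $G$ be a closed subgroup of $\prod_i G_i$ and let $\{g_n : n\in L\}\subseteq G$ be a family indexed by a countable set $L$. - The family is a generating set for $G$ (equivalently, it topologically generates $G$) if all $g_n$ have finite support and the subgroup $\bigoplus_{n\in L}\langle g_n\rangle$ (the internal direct sum of the cyclic subgroups $\langle g_n\rangle$) is dense in $G$.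 - If, in addition, the map $\Phi\colon\bigoplus_{n\in L}\langle g_n\rangle\to G$, $\Phi((x_n))=\sum_n x_n$ (with $x_n\in\langle g_n\rangle$), extends to a topological group isomorphism $\Phi\colon\prod_{n\in L}\langle g_n\rangle\to G$ onto $G$ (each $\langle g_n\rangle$ discrete, product topology), then $G$ is called weakly rectangular and $\Phi$ is called an isomorphic encoder of $G$. - If, finally, $\Phi\bigl(\bigoplus_{n\in L}\langle g_n\rangle\bigr)=G\cap\bigoplus_{i\in\mathbb{N}}G_i$, then $G$ is called an implicit direct product. Thus $G$ is weakly rectangular (respectively, an implicit direct product) if there exists a generating set for $G$ with the corresponding properties. **Other notation.** For an abelian group $A$ and a prime $p$: $(A)_p$ is the largest $p$-subgroup of $A$ (the elements whose order is a power of $p$), and $A[p]=\{a\in A : pa=0\}$. $\mathbb{P}_G$ is the set of primes $p$ such that $G$ contains a nontrivial $p$-subgroup. $G$ has finite exponent if there is a positive integer $n$ with $ng=0$ for all $g\in G$. *)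

theory Defs
  imports "HOL-Analysis.Analysis" "HOL-Algebra.Algebra"
begin

text \<open>
  Abelian groups are rendered by \<^const>\<open>comm_group\<close>, so the usual additive notation becomes
  multiplicative: \<open>0\<close> is \<open>\<one>\<close>, \<open>n x\<close> is \<open>x [^] n\<close>, and finite sums are \<^const>\<open>gfinprod\<close>
  (the product over the indices with a value other than \<open>\<one>\<close>).
  The index set \<open>{1, 2, 3, ...}\<close> is \<open>{1..}\<close>; the values \<open>Gs 0\<close> are never used.
\<close>

abbreviation prod_grp :: "(nat \<Rightarrow> ('a, 'b) monoid_scheme) \<Rightarrow> (nat \<Rightarrow> 'a) monoid" where
  "prod_grp Gs \<equiv> product_group {1..} Gs"

definition prod_top :: "(nat \<Rightarrow> ('a, 'b) monoid_scheme) \<Rightarrow> (nat \<Rightarrow> 'a) topology" where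
  "prod_top Gs = product_topology (\<lambda>i. discrete_topology (carrier (Gs i))) {1..}"

definition supp :: "(nat \<Rightarrow> ('a, 'b) monoid_scheme) \<Rightarrow> (nat \<Rightarrow> 'a) \<Rightarrow> nat set" where
  "supp Gs x = {i \<in> {1..}. x i \<noteq> \<one>\<^bsub>Gs i\<^esub>}"

definition fin_supp :: "(nat \<Rightarrow> ('a, 'b) monoid_scheme) \<Rightarrow> (nat \<Rightarrow> 'a) set" where
  "fin_supp Gs = {x \<in> carrier (prod_grp Gs). finite (supp Gs x)}"

definition order_controllable ::
    "(nat \<Rightarrow> ('a, 'b) monoid_scheme) \<Rightarrow> (nat \<Rightarrow> 'a) set \<Rightarrow> bool" where
  "order_controllable Gs G \<longleftrightarrow>
     (\<forall>i\<ge>1. \<exists>n\<ge>1. \<forall>c\<in>G. \<exists>c1\<in>G.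
        restrict c1 {1..i} = restrict c {1..i} \<and>
        supp Gs c1 \<subseteq> {1..n} \<and>
        group.ord (prod_grp Gs) c1 dvd group.ord (product_group {1..n} Gs) (restrict c {1..n}))"

definition weakly_observable ::
    "(nat \<Rightarrow> ('a, 'b) monoid_scheme) \<Rightarrow> (nat \<Rightarrow> 'a) set \<Rightarrow> bool" where
  "weakly_observable Gs H \<longleftrightarrow>
     H \<inter> fin_supp Gs = (prod_top Gs closure_of H) \<inter> fin_supp Gs"

text \<open>
  For a family \<open>B\<close> of subgroups of \<open>P\<close> indexed by \<open>L\<close> (given by generating sets), the internal direct
  sum is the image of the external direct sum \<^const>\<open>sum_group\<close> under the summation map; the sum is
  direct when that map is injective. Families with trivial members \<open>B n\<close> are allowed.
\<close>

definition ext_sum :: "('a, 'b) monoid_scheme \<Rightarrow> 'l set \<Rightarrow> ('l \<Rightarrow> 'a set) \<Rightarrow> ('l \<Rightarrow> 'a) set" where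
  "ext_sum P L B = carrier (sum_group L (\<lambda>n. subgroup_generated P (B n)))"

definition int_sum :: "('a, 'b) monoid_scheme \<Rightarrow> 'l set \<Rightarrow> ('l \<Rightarrow> 'a set) \<Rightarrow> 'a set" where
  "int_sum P L B = (\<lambda>x. gfinprod P x L) ` ext_sum P L B"

definition is_direct :: "('a, 'b) monoid_scheme \<Rightarrow> 'l set \<Rightarrow> ('l \<Rightarrow> 'a set) \<Rightarrow> bool" where
  "is_direct P L B \<longleftrightarrow> inj_on (\<lambda>x. gfinprod P x L) (ext_sum P L B)"

definition generating_set ::
    "(nat \<Rightarrow> ('a, 'b) monoid_scheme) \<Rightarrow> (nat \<Rightarrow> 'a) set \<Rightarrow> 'l set \<Rightarrow> ('l \<Rightarrow> nat \<Rightarrow> 'a) \<Rightarrow> bool" where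
  "generating_set Gs G L g \<longleftrightarrow>
     countable L \<and> g ` L \<subseteq> G \<inter> fin_supp Gs \<and>
     is_direct (prod_grp Gs) L (\<lambda>n. {g n}) \<and>
     subtopology (prod_top Gs) G closure_of int_sum (prod_grp Gs) L (\<lambda>n. {g n}) = G"

definition isomorphic_encoder ::
    "(nat \<Rightarrow> ('a, 'b) monoid_scheme) \<Rightarrow> (nat \<Rightarrow> 'a) set \<Rightarrow> 'l set \<Rightarrow> ('l \<Rightarrow> nat \<Rightarrow> 'a)
      \<Rightarrow> (('l \<Rightarrow> nat \<Rightarrow> 'a) \<Rightarrow> nat \<Rightarrow> 'a) \<Rightarrow> bool" where
  "isomorphic_encoder Gs G L g \<Phi> \<longleftrightarrow>
     generating_set Gs G L g \<and>
     (\<forall>x \<in> ext_sum (prod_grp Gs) L (\<lambda>n. {g n}). \<Phi> x = gfinprod (prod_grp Gs) x L) \<and>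
     \<Phi> \<in> iso (product_group L (\<lambda>n. subgroup_generated (prod_grp Gs) {g n}))
             (subgroup_generated (prod_grp Gs) G) \<and>
     homeomorphic_map
       (product_topology
         (\<lambda>n. discrete_topology (carrier (subgroup_generated (prod_grp Gs) {g n}))) L)
       (subtopology (prod_top Gs) G) \<Phi>"

text \<open>
  A countable index set can be taken to be a set of natural numbers, which avoids quantifying
  over index types.
\<close>

definition weakly_rectangular ::
    "(nat \<Rightarrow> ('a, 'b) monoid_scheme) \<Rightarrow> (nat \<Rightarrow> 'a) set \<Rightarrow> bool" where
  "weakly_rectangular Gs G \<longleftrightarrow> (\<exists>(L :: nat set) g \<Phi>. isomorphic_encoder Gs G L g \<Phi>)"

definition implicit_direct_product ::
    "(nat \<Rightarrow> ('a, 'b) monoid_scheme) \<Rightarrow> (nat \<Rightarrow> 'a) set \<Rightarrow> bool" where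
  "implicit_direct_product Gs G \<longleftrightarrow>
     (\<exists>(L :: nat set) g \<Phi>. isomorphic_encoder Gs G L g \<Phi> \<and>
        \<Phi> ` ext_sum (prod_grp Gs) L (\<lambda>n. {g n}) = G \<inter> fin_supp Gs)"

definition p_part :: "('a, 'b) monoid_scheme \<Rightarrow> nat \<Rightarrow> 'a set \<Rightarrow> 'a set" where
  "p_part P p A = {a \<in> A. \<exists>k. group.ord P a = p ^ k}"

definition p_socle :: "('a, 'b) monoid_scheme \<Rightarrow> nat \<Rightarrow> 'a set \<Rightarrow> 'a set" where
  "p_socle P p A = {a \<in> A. a [^]\<^bsub>P\<^esub> p = \<one>\<^bsub>P\<^esub>}"

definition primes_of :: "('a, 'b) monoid_scheme \<Rightarrow> 'a set \<Rightarrow> nat set" where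
  "primes_of P G =
     {p. Factorial_Ring.prime p \<and>
         (\<exists>H. subgroup H P \<and> H \<subseteq> G \<and> p_part P p H = H \<and> H \<noteq> {\<one>\<^bsub>P\<^esub>})}"

definition finite_exponent :: "('a, 'b) monoid_scheme \<Rightarrow> 'a set \<Rightarrow> bool" where
  "finite_exponent P G \<longleftrightarrow> (\<exists>n::nat. n > 0 \<and> (\<forall>g\<in>G. g [^]\<^bsub>P\<^esub> n = \<one>\<^bsub>P\<^esub>))"

end

theory Submission
  imports Defs
begin

text \<open>
  The group \<open>G\<close> is decomposed one finite cyclic summand at a time. Let \<open>R\<close> be an open subgroup of \<open>G\<close>
  that is not contained in the subgroup of elements vanishing on \<open>[1, i]\<close>; choose a maximal proper
  subgroup \<open>V\<close> of \<open>R\<close> containing \<open>R \<inter> {x. x = 0 on [1, i]}\<close>, say of index \<open>p\<close>, and an element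
  \<open>w \<in> R - V\<close> of least possible order \<open>p^(k+1)\<close>. Order controllability allows \<open>w\<close> to have finite
  support, and together with the minimality of \<open>k\<close> it shows that \<open>p^k w\<close> stays away from
  \<open>p^k V\<close>. An open subgroup \<open>S\<close> that contains \<open>p^k V\<close> and is maximal without \<open>p^k w\<close> is then a
  complement of \<open>\<langle>w\<rangle>\<close> in \<open>R\<close> inside \<open>V\<close>, so it has a smaller projection to \<open>[1, i]\<close> than \<open>R\<close>.
  Iterating, the complements shrink to zero, and summation is a topological isomorphism from the
  product of the groups \<open>\<langle>w\<^sub>m\<rangle>\<close> onto \<open>G\<close>, whether or not \<open>G\<close> has finite exponent.

  For the last assertion, let \<open>x = \<Sum> c\<^sub>m\<close> have finite support and order dividing \<open>N\<close>, and let \<open>p\<close> be a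
  prime divisor of \<open>N\<close>. Then \<open>(N/p) x\<close> lies in the closure of the \<open>p\<close>-socle, so weak observability makes
  it a finite sum; hence \<open>(N/p) c\<^sub>m = 0\<close> for almost all \<open>m\<close>, and one removes the other terms
  and continues by induction on \<open>N\<close>.
\<close>

section \<open>Cyclic direct summands\<close>

lemma (in group) subgroup_nat_pow_closed:
  assumes "subgroup H G" "h \<in> H"
  shows "h [^] (n::nat) \<in> H"
  using subgroup_int_pow_closed[OF assms, of "int n"] by (simp add: int_pow_int)

lemma (in group) subgroup_gcd_pow:
  fixes a b :: int
  assumes "subgroup H G" "y \<in> carrier G" "y [^] a \<in> H" "y [^] b \<in> H"
  shows "y [^] gcd a b \<in> H"
proof -
  obtain u v where "u * a + v * b = gcd a b"
    using bezout_int by blast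
  then have "y [^] gcd a b = (y [^] a) [^] u \<otimes> (y [^] b) [^] v"
    using assms(2) by (simp add: int_pow_pow int_pow_mult[symmetric] mult.commute)
  then show ?thesis
    using assms by (simp add: subgroup.m_closed subgroup_int_pow_closed)
qed

lemma (in group) subgroup_coprime_pow:
  fixes a b :: int
  assumes "subgroup H G" "y \<in> carrier G" "y [^] a \<in> H" "y [^] b \<in> H" "coprime a b"
  shows "y \<in> H"
  using subgroup_gcd_pow[OF assms(1-4)] assms(2,5) by (simp add: coprime_iff_gcd_eq_1)

text \<open>Prime factors are stripped from \<open>n\<close> until the power of \<open>y\<close>
  leaves \<open>H\<close>; the last prime stripped is then the order of that power modulo
  \<open>H\<close>.\<close>

lemma (in group) prime_pow_in_subgroup:
  fixes n :: nat
  assumes "subgroup H G" "y \<in> carrier G" "y \<notin> H" "y [^] n \<in> H" "n > 0"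
  obtains q :: nat and t :: nat where "Factorial_Ring.prime q" "y [^] t \<notin> H" "(y [^] t) [^] q \<in> H"
proof -
  have "\<exists>(q::nat) (t::nat). Factorial_Ring.prime q \<and> y [^] t \<notin> H \<and> (y [^] t) [^] q \<in> H"
    using assms(4,5)
  proof (induction n rule: less_induct)
    case (less n)
    have "n \<noteq> 1"
      using assms less.prems by (auto simp: nat_pow_def)
    then obtain q where q: "Factorial_Ring.prime q" "q dvd n"
      using prime_factor_nat by blast
    then obtain m where m: "n = m * q"
      by (metis dvd_def mult.commute)
    have eq: "(y [^] m) [^] q = y [^] n"
      using assms m by (simp add: nat_pow_pow)
    show ?case
    proof (cases "y [^] m \<in> H")
      case True
      moreover have "m < n" "m > 0"
        using m q less.prems prime_gt_1_nat[OF q(1)] by auto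
      ultimately show ?thesis
        using less.IH by blast
    next
      case False
      moreover have "(y [^] m) [^] q \<in> H"
        using eq less.prems by simp
      ultimately show ?thesis
        using q(1) by blast
    qed
  qed
  then show thesis
    using that by blast
qed

lemma (in group) mem_adjoin_iff:
  assumes "y \<in> carrier G"
  shows "u \<in> H <#> generate G {y} \<longleftrightarrow> (\<exists>h\<in>H. \<exists>d::int. u = h \<otimes> y [^] d)"
  unfolding set_mult_def generate_pow[OF assms] by auto

lemma (in comm_group) subgroup_adjoin:
  assumes "subgroup H G" "y \<in> carrier G"
  shows "subgroup (H <#> generate G {y}) G" "H \<subseteq> H <#> generate G {y}" "y \<in> H <#> generate G {y}"
proof -
  have g: "subgroup (generate G {y}) G"
    using assms generate_is_subgroup by simp
  then show "subgroup (H <#> generate G {y}) G"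
    using assms mult_subgroups by simp
  have "h \<in> H <#> generate G {y}" if "h \<in> H" for h
    unfolding mem_adjoin_iff[OF assms(2)] using that subgroup.mem_carrier[OF assms(1) that]
    by (intro bexI[of _ h] exI[of _ 0]) auto
  then show "H \<subseteq> H <#> generate G {y}"
    by blast
  show "y \<in> H <#> generate G {y}"
    unfolding mem_adjoin_iff[OF assms(2)] using assms subgroup.one_closed
    by (intro bexI[of _ \<one>] exI[of _ 1]) auto
qed

lemma (in group) adjoin_subset:
  assumes "subgroup K G" "H \<subseteq> K" "y \<in> K"
  shows "H <#> generate G {y} \<subseteq> K"
proof
  fix u assume "u \<in> H <#> generate G {y}"
  then obtain h and d :: int where hd: "h \<in> H" "u = h \<otimes> y [^] d"
    using mem_adjoin_iff[OF subgroup.mem_carrier[OF assms(1,3)]] by blast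
  have "h \<in> K"
    using hd(1) assms(2) by blast
  then show "u \<in> K"
    unfolding hd(2) using subgroup.m_closed[OF assms(1)] subgroup_int_pow_closed[OF assms(1,3)] by blast
qed

text \<open>Let \<open>z = x [^] (p ^ k)\<close>, whose image in the torsion quotient of
  \<open>R\<close> by \<open>R'\<close> has order \<open>p\<close>. By \<open>max\<close>, every
  nontrivial subgroup of this quotient contains that image, and by \<open>pV\<close> together with
  the third clause of \<open>R'\<close> its exponent divides \<open>p ^ Suc k\<close>. Such a
  quotient is cyclic of order \<open>p ^ Suc k\<close>, generated by the image of \<open>x\<close>.
  The proof argues with elements instead of quoting the structure of such groups.\<close>

lemma (in comm_group) cyclic_splitting:
  fixes p k :: nat
  assumes R: "subgroup R G" and V: "subgroup V G" "V \<subseteq> R"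
    and Vmax: "\<And>r. r \<in> R - V \<Longrightarrow> R \<subseteq> V <#> generate G {r}"
    and p: "Factorial_Ring.prime p" and x: "x \<in> R" "x [^] (p ^ Suc k) = \<one>"
    and pV: "\<And>r. r \<in> R \<Longrightarrow> r [^] p \<in> V"
    and R': "subgroup R' G" "R' \<subseteq> R" "\<And>v. v \<in> V \<Longrightarrow> v [^] (p ^ k) \<in> R'" "x [^] (p ^ k) \<notin> R'"
    and tors: "\<And>r. r \<in> R \<Longrightarrow> \<exists>n>0. r [^] (n::nat) \<in> R'"
    and max: "\<And>S. subgroup S G \<Longrightarrow> R' \<subset> S \<Longrightarrow> S \<subseteq> R \<Longrightarrow> x [^] (p ^ k) \<in> S"
  shows "R' \<subseteq> V" "R' \<inter> generate G {x} = {\<one>}" "R' <#> generate G {x} = R"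
proof -
  define z where "z = x [^] (p ^ k)"
  have Rc: "r \<in> carrier G" if "r \<in> R" for r
    using subgroup.mem_carrier[OF R that] .
  then have xc: "x \<in> carrier G" and zc: "z \<in> carrier G"
    using x(1) unfolding z_def by auto
  have zp: "z [^] p = \<one>"
    using x xc by (simp add: z_def nat_pow_pow mult.commute)
  have z_coprime: False if "z [^] (c::int) \<in> R'" "\<not> int p dvd c" for c
  proof -
    have "coprime c (int p)"
      using that p prime_imp_coprime[of "int p" c] by (simp add: coprime_commute)
    moreover have "z [^] int p \<in> R'"
      using zp R'(1) subgroup.one_closed by (simp add: int_pow_int)
    ultimately have "z \<in> R'"
      using subgroup_coprime_pow[OF R'(1) zc that(1)] by blast
    then show False
      using R'(4) z_def by simp
  qed
  show "R' \<subseteq> V"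
  proof
    fix r assume r: "r \<in> R'"
    show "r \<in> V"
    proof (rule ccontr)
      assume "r \<notin> V"
      have rc: "r \<in> carrier G"
        using r R'(2) Rc by blast
      \<comment> \<open>An \<open>r\<close> in \<open>R'\<close> outside \<open>V\<close> would
        generate \<open>R\<close> together with \<open>V\<close>. Writing \<open>x\<close> in these
        terms and raising to the power \<open>p ^ k\<close> sends the part in \<open>V\<close> into
        \<open>R'\<close>, so \<open>z\<close> would lie in \<open>R'\<close>.\<close>
      then have "x \<in> V <#> generate G {r}"
        using Vmax[of r] r R'(2) x(1) \<open>r \<notin> V\<close> by blast
      then obtain v and d :: int where v: "v \<in> V" "x = v \<otimes> r [^] d"
        using mem_adjoin_iff[OF rc] by blast
      have "r [^] d \<in> R'"
        using r R'(1) subgroup_int_pow_closed by simp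
      moreover have "v \<in> carrier G" "r [^] d \<in> carrier G"
        using v(1) V(2) rc Rc by auto
      then have "z = v [^] (p ^ k) \<otimes> (r [^] d) [^] (p ^ k)"
        using v by (simp add: z_def nat_pow_distrib)
      ultimately show False
        using R'(1,4) R'(3)[OF v(1)] z_def subgroup.m_closed subgroup_nat_pow_closed by metis
    qed
  qed
  show "R' \<inter> generate G {x} = {\<one>}"
  proof -
    have "u = \<one>" if u: "u \<in> R'" "u \<in> generate G {x}" for u
    proof (rule ccontr)
      assume "u \<noteq> \<one>"
      obtain j :: int where j: "u = x [^] j"
        using u(2) generate_pow[OF xc] by auto
      have one: "x [^] int (p ^ Suc k) = \<one>"
        using x(2) by (simp only: int_pow_int)
      have "\<not> int (p ^ Suc k) dvd j"
      proof
        assume "int (p ^ Suc k) dvd j"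
        then obtain c where "j = int (p ^ Suc k) * c" by blast
        then have "x [^] j = (x [^] int (p ^ Suc k)) [^] c"
          using xc by (simp add: int_pow_pow)
        then show False using one j \<open>u \<noteq> \<one>\<close> by simp
      qed
      \<comment> \<open>\<open>u\<close> and \<open>x [^] (p ^ Suc k) = \<one>\<close> both lie in
        \<open>R'\<close>, so by Bezout \<open>R'\<close> contains the power of \<open>x\<close>
        whose exponent is the gcd \<open>p ^ e\<close>. As \<open>e \<le> k\<close>, a further power
        of it is \<open>z\<close>.\<close>
      obtain e where e: "e \<le> Suc k" "gcd (nat \<bar>j\<bar>) (p ^ Suc k) = p ^ e"
        using divides_primepow_nat[OF p, of "gcd (nat \<bar>j\<bar>) (p ^ Suc k)" "Suc k"] gcd_dvd2 by blast
      have g: "gcd j (int (p ^ Suc k)) = int (p ^ e)"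
        using e(2) by (metis abs_of_nat gcd_int_def nat_int)
      have "e \<noteq> Suc k"
        using g \<open>\<not> int (p ^ Suc k) dvd j\<close> by (metis gcd_dvd1)
      then have "e \<le> k" using e by simp
      have "x [^] gcd j (int (p ^ Suc k)) \<in> R'"
        using subgroup_gcd_pow[OF R'(1) xc] u(1) j one R'(1) subgroup.one_closed by metis
      then have "x [^] (p ^ e) \<in> R'"
        unfolding g int_pow_int .
      then have "(x [^] (p ^ e)) [^] (p ^ (k - e)) \<in> R'"
        using subgroup_nat_pow_closed[OF R'(1)] by blast
      then have "x [^] (p ^ k) \<in> R'"
        using xc \<open>e \<le> k\<close> by (simp add: nat_pow_pow flip: power_add)
      then show False using R'(4) by simp
    qed
    then show ?thesis
      using R'(1) subgroup.one_closed generate.one by blast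
  qed
  define Q where "Q = R' <#> generate G {x}"
  have Q: "subgroup Q G" "R' \<subseteq> Q" "x \<in> Q"
    unfolding Q_def using subgroup_adjoin[OF R'(1) xc] by auto
  have "Q \<subseteq> R"
    unfolding Q_def using adjoin_subset[OF R R'(2) x(1)] .
  moreover have "R \<subseteq> Q"
  proof (rule ccontr)
    assume "\<not> R \<subseteq> Q"
    then obtain y0 where y0: "y0 \<in> R" "y0 \<notin> Q" by blast
    obtain n where n: "n > 0" "y0 [^] (n::nat) \<in> R'"
      using tors[OF y0(1)] by blast
    \<comment> \<open>If \<open>Q\<close> were smaller than \<open>R\<close>, some element of
      \<open>R\<close> would have prime order \<open>q\<close> modulo \<open>Q\<close>. The plan is
      to correct it by a power of \<open>x\<close> so that its \<open>q\<close>-th power falls into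
      \<open>R'\<close>, not just into \<open>Q\<close>.\<close>
    obtain q t where q: "Factorial_Ring.prime q" "y0 [^] (t::nat) \<notin> Q" "(y0 [^] t) [^] (q::nat) \<in> Q"
      by (rule prime_pow_in_subgroup[OF Q(1) Rc[OF y0(1)] y0(2), of n]) (use n Q in auto)
    define y where "y = y0 [^] t"
    have yR: "y \<in> R"
      unfolding y_def using y0(1) by (rule subgroup_nat_pow_closed[OF R])
    have yc: "y \<in> carrier G" using Rc yR by simp
    obtain r and c :: int where rc: "r \<in> R'" "y [^] q = r \<otimes> x [^] c"
      using q(3) unfolding Q_def mem_adjoin_iff[OF xc] y_def by blast
    have rcc: "r \<in> carrier G"
      using rc(1) R'(2) Rc by blast
    \<comment> \<open>The component of \<open>y [^] q\<close> along \<open>x\<close> is a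
      \<open>q\<close>-th power. For \<open>q = p\<close>, the element \<open>y [^] p\<close> lies
      in \<open>V\<close>, so its \<open>p ^ k\<close>-th power lies in \<open>R'\<close>; this
      forces \<open>z [^] c\<close> into \<open>R'\<close>, hence \<open>p\<close> divides
      \<open>c\<close>. For other \<open>q\<close>, multiplication by \<open>q\<close> is invertible
      modulo \<open>p ^ Suc k\<close>.\<close>
    have "\<exists>c'. x [^] c = x [^] (int q * c')"
    proof (cases "q = p")
      case True
      have "int p dvd c"
      proof (rule ccontr)
        assume nd: "\<not> int p dvd c"
        have "(y [^] q) [^] (p ^ k) \<in> R'"
          using True pV yR R'(3) by simp
        moreover have "(y [^] q) [^] (p ^ k) = r [^] (p ^ k) \<otimes> (x [^] c) [^] (p ^ k)"
          using rc rcc xc by (simp add: nat_pow_distrib)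
        moreover have "(x [^] c) [^] (p ^ k) = z [^] c"
          unfolding z_def using xc by (simp add: int_pow_pow mult.commute flip: int_pow_int)
        moreover have "r [^] (p ^ k) \<in> R'"
          using rc subgroup_nat_pow_closed[OF R'(1)] by blast
        moreover have "z [^] c = inv (r [^] (p ^ k)) \<otimes> (r [^] (p ^ k) \<otimes> z [^] c)"
          using rcc zc by (simp add: m_assoc[symmetric])
        ultimately have "z [^] c \<in> R'"
          using R'(1) subgroup.m_closed subgroup.m_inv_closed by metis
        then show False using z_coprime nd by blast
      qed
      then show ?thesis using True by auto
    next
      case False
      then have "coprime (int q) (int (p ^ Suc k))"
        using p q(1) by (simp add: primes_coprime)
      then obtain u v where uv: "u * int q + v * int (p ^ Suc k) = 1"
        using bezout_int by (metis coprime_iff_gcd_eq_1)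
      have "c = int q * (u * c) + int (p ^ Suc k) * (v * c)"
        by (subst mult_1[symmetric, of c], subst uv[symmetric]) (simp only: algebra_simps)
      then have "x [^] c = x [^] (int q * (u * c)) \<otimes> (x [^] int (p ^ Suc k)) [^] (v * c)"
        using xc by (metis int_pow_mult int_pow_pow)
      moreover have "x [^] int (p ^ Suc k) = \<one>"
        using x(2) by (simp only: int_pow_int)
      ultimately show ?thesis
        using xc by auto
    qed
    then obtain c' where c': "x [^] c = x [^] (int q * c')" by blast
    define y' where "y' = y \<otimes> inv (x [^] c')"
    have y'c: "y' \<in> carrier G" using yc xc y'_def by simp
    have y'R: "y' \<in> R"
      unfolding y'_def using yR x(1) R
      by (simp add: subgroup.m_closed subgroup.m_inv_closed subgroup_int_pow_closed)
    have "y = y' \<otimes> x [^] c'"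
      unfolding y'_def using yc xc by (simp add: m_assoc)
    then have y'Q: "y' \<notin> Q"
      using q(2) y_def Q subgroup.m_closed subgroup_int_pow_closed by metis
    have "y' [^] q = y [^] q \<otimes> inv (x [^] (int q * c'))"
      unfolding y'_def using yc xc
      by (simp add: int_pow_distrib int_pow_inv int_pow_pow mult.commute flip: int_pow_int)
    also have "\<dots> = r"
      using rc rcc c' xc by (simp add: m_assoc)
    finally have y'q: "y' [^] q \<in> R'" using rc by simp
    \<comment> \<open>\<open>y'\<close> is outside \<open>R'\<close>, so maximality puts
      \<open>z\<close> into \<open>S\<close>, say \<open>z = h \<otimes> y' [^] d\<close>. If
      \<open>q\<close> divides \<open>d\<close>, then \<open>z\<close> lies in \<open>R'\<close>.
      Otherwise \<open>Q\<close> contains \<open>y' [^] d\<close> and \<open>y' [^] q\<close> with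
      coprime exponents, and so contains \<open>y'\<close>. Both are impossible.\<close>
    define S where "S = R' <#> generate G {y'}"
    have S: "subgroup S G" "R' \<subseteq> S" "y' \<in> S"
      unfolding S_def using subgroup_adjoin[OF R'(1) y'c] by auto
    have "S \<subseteq> R"
      unfolding S_def using adjoin_subset[OF R R'(2) y'R] .
    moreover have "R' \<subset> S" using S(2,3) Q(2) y'Q by blast
    ultimately have "z \<in> S" using max[OF S(1)] z_def by simp
    then obtain h and d :: int where hd: "h \<in> R'" "z = h \<otimes> y' [^] d"
      unfolding S_def mem_adjoin_iff[OF y'c] by blast
    have hc: "h \<in> carrier G" using hd(1) R'(2) Rc by blast
    show False
    proof (cases "int q dvd d")
      case True
      then obtain d' where "d = int q * d'" by blast
      then have "y' [^] d = (y' [^] q) [^] d'"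
        using y'c by (simp add: int_pow_pow flip: int_pow_int)
      then have "z \<in> R'"
        using hd R'(1) y'q subgroup.m_closed subgroup_int_pow_closed by metis
      then show False using R'(4) z_def by simp
    next
      case False
      then have cop: "coprime d (int q)"
        using q(1) prime_imp_coprime[of "int q" d] by (simp add: coprime_commute)
      have "y' [^] d = inv h \<otimes> z"
        using hd hc y'c by (simp add: m_assoc[symmetric])
      moreover have "z \<in> Q"
        unfolding z_def using Q(3) by (rule subgroup_nat_pow_closed[OF Q(1)])
      ultimately have "y' [^] d \<in> Q"
        using Q hd subgroup.m_closed subgroup.m_inv_closed by (metis subset_iff)
      moreover have "y' [^] int q \<in> Q"
        using y'q Q by (auto simp: int_pow_int)
      ultimately show False
        using subgroup_coprime_pow[OF Q(1) y'c] cop y'Q by blast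
    qed
  qed
  ultimately show "R' <#> generate G {x} = R"
    unfolding Q_def by blast
qed

section \<open>Products of finite abelian groups\<close>

text \<open>
  The operations of a product group are kept folded, so that the group laws apply to them; with
  \<open>One_nat_def\<close> as a simplification rule, the index set \<open>{1..}\<close> inside \<^const>\<open>product_group\<close> would become
  \<open>{Suc 0..}\<close>.
\<close>

declare carrier_product_group [simp del] one_product_group [simp del] mult_product_group [simp del]
  inv_product_group [simp del] One_nat_def [simp del]

lemma pow_product_group:
  assumes "i \<in> I"
  shows "(x [^]\<^bsub>product_group I K\<^esub> (n::nat)) i = x i [^]\<^bsub>K i\<^esub> n"
  using assms by (induction n) (simp_all add: one_product_group mult_product_group)

text \<open>Agreement up to \<open>n\<close> describes the basic neighbourhoods of a point, because
  the factors are discrete. Coordinates start at 1, so \<open>agree 0\<close> always holds.\<close>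

definition agree :: "nat \<Rightarrow> (nat \<Rightarrow> 'a) \<Rightarrow> (nat \<Rightarrow> 'a) \<Rightarrow> bool" where
  "agree n x y \<longleftrightarrow> (\<forall>j\<in>{1..n}. x j = y j)"

lemma agree_mono: "agree n x y \<Longrightarrow> m \<le> n \<Longrightarrow> agree m x y"
  unfolding agree_def by auto

lemma agree_sym: "agree n x y \<Longrightarrow> agree n y x"
  unfolding agree_def by auto

locale finite_comm_groups =
  fixes Gs :: "nat \<Rightarrow> ('a, 'b) monoid_scheme"
  assumes comm_factor: "\<And>i. i \<ge> 1 \<Longrightarrow> comm_group (Gs i)"
    and finite_factor: "\<And>i. i \<ge> 1 \<Longrightarrow> finite (carrier (Gs i))"
begin

abbreviation P :: "(nat \<Rightarrow> 'a) monoid" where "P \<equiv> prod_grp Gs"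

lemma group_factor: "i \<ge> 1 \<Longrightarrow> group (Gs i)"
  using comm_factor comm_group.axioms(2) by blast

sublocale P: comm_group P
proof (rule group.group_comm_groupI)
  show "group P"
    by (rule product_group) (simp add: group_factor)
  fix x y assume "x \<in> carrier P" "y \<in> carrier P"
  then show "x \<otimes>\<^bsub>P\<^esub> y = y \<otimes>\<^bsub>P\<^esub> x"
    using comm_factor
    by (auto simp: mult_product_group carrier_product_group PiE_iff comm_monoid.m_comm comm_group_def)
qed

lemma coord_closed: "x \<in> carrier P \<Longrightarrow> i \<ge> 1 \<Longrightarrow> x i \<in> carrier (Gs i)"
  by (auto simp: carrier_product_group)

lemma P_eqI: "x \<in> carrier P \<Longrightarrow> y \<in> carrier P \<Longrightarrow> (\<And>i. i \<ge> 1 \<Longrightarrow> x i = y i) \<Longrightarrow> x = y"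
  unfolding carrier_product_group by (rule PiE_ext) auto

lemma coord_simps:
  assumes "i \<ge> 1"
  shows "\<one>\<^bsub>P\<^esub> i = \<one>\<^bsub>Gs i\<^esub>" "(x \<otimes>\<^bsub>P\<^esub> y) i = x i \<otimes>\<^bsub>Gs i\<^esub> y i"
    "(x [^]\<^bsub>P\<^esub> (n::nat)) i = x i [^]\<^bsub>Gs i\<^esub> n"
    "x \<in> carrier P \<Longrightarrow> (inv\<^bsub>P\<^esub> x) i = inv\<^bsub>Gs i\<^esub> (x i)"
  using assms group_factor inv_product_group[of x "{1..}" Gs]
  by (simp_all add: one_product_group mult_product_group pow_product_group carrier_product_group)

definition tail :: "nat \<Rightarrow> (nat \<Rightarrow> 'a) set" where
  "tail n = {x \<in> carrier P. agree n x \<one>\<^bsub>P\<^esub>}"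

lemma tail_mono: "m \<le> n \<Longrightarrow> tail n \<subseteq> tail m"
  unfolding tail_def using agree_mono by blast

lemma agree_mult:
  assumes "agree n x y" "agree n u v"
  shows "agree n (x \<otimes>\<^bsub>P\<^esub> u) (y \<otimes>\<^bsub>P\<^esub> v)"
  using assms by (simp add: agree_def coord_simps)

lemma agree_inv:
  assumes "agree n x y" "x \<in> carrier P" "y \<in> carrier P"
  shows "agree n (inv\<^bsub>P\<^esub> x) (inv\<^bsub>P\<^esub> y)"
  using assms by (simp add: agree_def coord_simps)

lemma subgroup_tail: "subgroup (tail n) P"
proof
  fix x y assume xy: "x \<in> tail n" "y \<in> tail n"
  then show "x \<otimes>\<^bsub>P\<^esub> y \<in> tail n"
    using agree_mult[of n x "\<one>\<^bsub>P\<^esub>" y "\<one>\<^bsub>P\<^esub>"] by (simp add: tail_def)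
  show "inv\<^bsub>P\<^esub> x \<in> tail n"
    using xy agree_inv[of n x "\<one>\<^bsub>P\<^esub>"] by (simp add: tail_def)
qed (auto simp: tail_def agree_def)

lemma agree_iff_tail:
  assumes "x \<in> carrier P" "y \<in> carrier P"
  shows "agree n x y \<longleftrightarrow> x \<otimes>\<^bsub>P\<^esub> inv\<^bsub>P\<^esub> y \<in> tail n"
proof -
  have "agree n (x \<otimes>\<^bsub>P\<^esub> inv\<^bsub>P\<^esub> y) \<one>\<^bsub>P\<^esub>" if "agree n x y"
    using agree_mult[OF that agree_inv[of n y y]] assms by (simp add: agree_def)
  moreover have "agree n x y" if "agree n (x \<otimes>\<^bsub>P\<^esub> inv\<^bsub>P\<^esub> y) \<one>\<^bsub>P\<^esub>"
    using agree_mult[OF that, of y y] assms by (simp add: agree_def P.m_assoc)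
  ultimately show ?thesis
    using assms by (auto simp: tail_def)
qed

text \<open>\<open>R\<close> is a union of cosets of \<open>G \<inter> tail n\<close>, so for
  elements of \<open>G\<close> membership in \<open>R\<close> can be read off from the first
  \<open>n\<close> coordinates.\<close>

lemma mem_if_agree:
  assumes "subgroup G P" "subgroup R P" "R \<subseteq> G" "G \<inter> tail n \<subseteq> R" "x \<in> G" "y \<in> R" "agree n x y"
  shows "x \<in> R"
proof -
  have c: "x \<in> carrier P" "y \<in> carrier P"
    using subgroup.mem_carrier[OF assms(1,5)] subgroup.mem_carrier[OF assms(2,6)] by auto
  have "x \<otimes>\<^bsub>P\<^esub> inv\<^bsub>P\<^esub> y \<in> G"
    using assms by (simp add: subgroup.m_closed subgroup.m_inv_closed subset_iff)
  then have "x \<otimes>\<^bsub>P\<^esub> inv\<^bsub>P\<^esub> y \<in> R"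
    using assms agree_iff_tail c by blast
  then have "(x \<otimes>\<^bsub>P\<^esub> inv\<^bsub>P\<^esub> y) \<otimes>\<^bsub>P\<^esub> y \<in> R"
    using assms subgroup.m_closed by fastforce
  then show ?thesis
    using c by (simp add: P.m_assoc)
qed

text \<open>By \<open>mem_if_agree\<close> such an \<open>R\<close> is determined by its image in
  the finite product of the first \<open>n\<close> factors.\<close>

lemma finite_supergroups_tail:
  assumes "subgroup G P"
  shows "finite {R. subgroup R P \<and> R \<subseteq> G \<and> G \<inter> tail n \<subseteq> R}" (is "finite ?A")
proof (rule inj_on_finite[where f = "(`) (\<lambda>x. restrict x {1..n})"])
  have "restrict x {1..n} \<in> PiE {1..n} (\<lambda>i. carrier (Gs i))" if "x \<in> G" for x
    using coord_closed[OF subgroup.mem_carrier[OF assms that]] by auto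
  then show "(`) (\<lambda>x. restrict x {1..n}) ` ?A \<subseteq> Pow (PiE {1..n} (\<lambda>i. carrier (Gs i)))"
    by blast
  show "finite (Pow (PiE {1..n} (\<lambda>i. carrier (Gs i))))"
    using finite_factor by (auto intro!: finite_PiE)
  have sub: "R \<subseteq> S"
    if "R \<in> ?A" "S \<in> ?A" "(\<lambda>x. restrict x {1..n}) ` R = (\<lambda>x. restrict x {1..n}) ` S" for R S
  proof
    fix x assume x: "x \<in> R"
    then have "restrict x {1..n} \<in> (\<lambda>x. restrict x {1..n}) ` S"
      using that(3) by blast
    then obtain y where y: "y \<in> S" "restrict x {1..n} = restrict y {1..n}"
      by auto
    have "agree n x y"
      unfolding agree_def
    proof
      fix j assume "j \<in> {1..n}"
      then show "x j = y j"
        using fun_cong[OF y(2), of j] by simp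
    qed
    then show "x \<in> S"
      using mem_if_agree[OF assms, of S n x y] that x y by blast
  qed
  show "inj_on ((`) (\<lambda>x. restrict x {1..n})) ?A"
  proof (rule inj_onI)
    fix R S assume "R \<in> ?A" "S \<in> ?A" "(\<lambda>x. restrict x {1..n}) ` R = (\<lambda>x. restrict x {1..n}) ` S"
    then show "R = S"
      using sub[of R S] sub[of S R] by (simp only: subset_antisym)
  qed
qed

text \<open>By Lagrange the product of the orders of the factors serves. Consequently a fixed power
  maps everything into \<open>tail n\<close>, and every element of \<open>G\<close> is torsion
  modulo any open subgroup.\<close>

lemma torsion_coords: "\<exists>N>0. \<forall>x\<in>carrier P. \<forall>j\<in>{1..n}. x j [^]\<^bsub>Gs j\<^esub> (N::nat) = \<one>\<^bsub>Gs j\<^esub>"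
proof (intro exI conjI ballI)
  show "0 < (\<Prod>j\<in>{1..n}. order (Gs j))"
    using finite_factor group_factor
    by (auto intro!: prod_pos simp: group.is_monoid monoid.order_gt_0_iff_finite)
  fix x j assume xj: "x \<in> carrier P" "j \<in> {1..n}"
  then have j: "x j \<in> carrier (Gs j)" "group (Gs j)"
    using coord_closed group_factor by auto
  have "order (Gs j) dvd (\<Prod>j\<in>{1..n}. order (Gs j))"
    using xj by (intro dvd_prodI) auto
  then obtain m where "(\<Prod>j\<in>{1..n}. order (Gs j)) = order (Gs j) * m" ..
  then show "x j [^]\<^bsub>Gs j\<^esub> (\<Prod>j\<in>{1..n}. order (Gs j)) = \<one>\<^bsub>Gs j\<^esub>"
    using j group.pow_eq_id[OF j(2,1)] group.ord_dvd_group_order[OF j(2,1)] by simp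
qed

lemma fin_supp_torsion:
  assumes "x \<in> fin_supp Gs"
  shows "\<exists>N>0. x [^]\<^bsub>P\<^esub> (N::nat) = \<one>\<^bsub>P\<^esub>"
proof -
  have x: "x \<in> carrier P" "finite (supp Gs x)"
    using assms by (auto simp: fin_supp_def)
  then obtain n where n: "supp Gs x \<subseteq> {..n}"
    using finite_nat_iff_bounded_le by blast
  obtain N :: nat where N: "N > 0" "\<forall>x\<in>carrier P. \<forall>j\<in>{1..n}. x j [^]\<^bsub>Gs j\<^esub> N = \<one>\<^bsub>Gs j\<^esub>"
    using torsion_coords by blast
  have "x [^]\<^bsub>P\<^esub> N = \<one>\<^bsub>P\<^esub>"
  proof (rule P_eqI)
    fix i :: nat assume i: "i \<ge> 1"
    show "(x [^]\<^bsub>P\<^esub> N) i = \<one>\<^bsub>P\<^esub> i"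
    proof (cases "i \<le> n")
      case True
      then show ?thesis using i N(2) x by (simp add: coord_simps)
    next
      case False
      then have "i \<notin> supp Gs x"
        using n by auto
      then have "x i = \<one>\<^bsub>Gs i\<^esub>"
        using i by (simp add: supp_def)
      then show ?thesis
        using i group_factor[OF i] by (simp add: coord_simps group.is_monoid monoid.nat_pow_one)
    qed
  qed (use x in auto)
  then show ?thesis using N(1) by blast
qed

lemma subgroup_fin_supp: "subgroup (fin_supp Gs) P"
proof
  fix x y assume xy: "x \<in> fin_supp Gs" "y \<in> fin_supp Gs"
  have "supp Gs (x \<otimes>\<^bsub>P\<^esub> y) \<subseteq> supp Gs x \<union> supp Gs y"
    using group_factor by (auto simp: supp_def coord_simps group.is_monoid)
  then show "x \<otimes>\<^bsub>P\<^esub> y \<in> fin_supp Gs"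
    using xy by (auto simp: fin_supp_def intro: finite_subset)
  have "supp Gs (inv\<^bsub>P\<^esub> x) \<subseteq> supp Gs x"
    using group_factor xy
    by (auto simp: supp_def coord_simps fin_supp_def group.is_monoid monoid.inv_one)
  then show "inv\<^bsub>P\<^esub> x \<in> fin_supp Gs"
    using xy by (auto simp: fin_supp_def intro: finite_subset)
next
  have "supp Gs \<one>\<^bsub>P\<^esub> = {}"
    by (auto simp: supp_def coord_simps)
  then show "\<one>\<^bsub>P\<^esub> \<in> fin_supp Gs"
    by (simp add: fin_supp_def)
qed (auto simp: fin_supp_def)

end

section \<open>Closed order controllable subgroups\<close>

locale controllable_group = finite_comm_groups Gs
  for Gs :: "nat \<Rightarrow> ('a, 'b) monoid_scheme" +
  fixes G :: "(nat \<Rightarrow> 'a) set"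
  assumes subgroup_G: "subgroup G P"
    and closed_G: "closedin (prod_top Gs) G"
    and controllable: "order_controllable Gs G"
begin

lemma G_carrier: "x \<in> G \<Longrightarrow> x \<in> carrier P"
  using subgroup.mem_carrier[OF subgroup_G] .

text \<open>Divisibility of orders is replaced by its consequence for exponents: whatever
  annihilates the first \<open>n\<close> coordinates of \<open>c\<close> annihilates
  \<open>a\<close>. This form needs no truncated product group, and \<open>n\<close> depends on
  \<open>i\<close> alone.\<close>

lemma controllable_approx:
  "\<exists>n. \<forall>c\<in>G. \<exists>a \<in> G \<inter> fin_supp Gs. agree i a c \<and>
     (\<forall>N::nat. (\<forall>j\<in>{1..n}. c j [^]\<^bsub>Gs j\<^esub> N = \<one>\<^bsub>Gs j\<^esub>) \<longrightarrow> a [^]\<^bsub>P\<^esub> N = \<one>\<^bsub>P\<^esub>)"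
proof -
  \<comment> \<open>Order controllability speaks of indices from 1 on; taking \<open>Suc i\<close>
    also covers \<open>i = 0\<close> and gives more agreement than required.\<close>
  obtain n where n: "\<forall>c\<in>G. \<exists>a\<in>G. restrict a {1..Suc i} = restrict c {1..Suc i} \<and> supp Gs a \<subseteq> {1..n} \<and>
        group.ord P a dvd group.ord (product_group {1..n} Gs) (restrict c {1..n})"
    using controllable[unfolded order_controllable_def, rule_format, of "Suc i"] by auto
  have "\<exists>a \<in> G \<inter> fin_supp Gs. agree i a c \<and>
     (\<forall>N::nat. (\<forall>j\<in>{1..n}. c j [^]\<^bsub>Gs j\<^esub> N = \<one>\<^bsub>Gs j\<^esub>) \<longrightarrow> a [^]\<^bsub>P\<^esub> N = \<one>\<^bsub>P\<^esub>)"
    if c: "c \<in> G" for c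
  proof -
    obtain a where a: "a \<in> G" "restrict a {1..Suc i} = restrict c {1..Suc i}" "supp Gs a \<subseteq> {1..n}"
        "group.ord P a dvd group.ord (product_group {1..n} Gs) (restrict c {1..n})"
      using n c by blast
    interpret Q: group "product_group {1..n} Gs"
      by (rule product_group) (simp add: group_factor)
    have "agree i a c"
      unfolding agree_def
    proof
      fix j assume "j \<in> {1..i}"
      then show "a j = c j"
        using fun_cong[OF a(2), of j] by simp
    qed
    moreover have "a \<in> fin_supp Gs"
      using a G_carrier by (auto simp: fin_supp_def intro: finite_subset)
    moreover have "a [^]\<^bsub>P\<^esub> N = \<one>\<^bsub>P\<^esub>" if N: "\<forall>j\<in>{1..n}. c j [^]\<^bsub>Gs j\<^esub> N = \<one>\<^bsub>Gs j\<^esub>" for N :: nat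
    proof -
      have rc: "restrict c {1..n} \<in> carrier (product_group {1..n} Gs)"
        using c G_carrier coord_closed by (auto simp: carrier_product_group)
      have "restrict c {1..n} [^]\<^bsub>product_group {1..n} Gs\<^esub> N = \<one>\<^bsub>product_group {1..n} Gs\<^esub>"
      proof (rule PiE_ext)
        show "restrict c {1..n} [^]\<^bsub>product_group {1..n} Gs\<^esub> N \<in> PiE {1..n} (\<lambda>i. carrier (Gs i))"
          using Q.nat_pow_closed[OF rc] by (simp add: carrier_product_group)
        show "\<one>\<^bsub>product_group {1..n} Gs\<^esub> \<in> PiE {1..n} (\<lambda>i. carrier (Gs i))"
          using Q.one_closed by (simp add: carrier_product_group)
      qed (use N in \<open>auto simp: pow_product_group one_product_group\<close>)
      then have "group.ord (product_group {1..n} Gs) (restrict c {1..n}) dvd N"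
        using Q.pow_eq_id[OF rc] by simp
      then show ?thesis
        using a(4) P.pow_eq_id[OF G_carrier[OF a(1)]] dvd_trans by blast
    qed
    ultimately show ?thesis using a(1) by blast
  qed
  then show ?thesis by blast
qed

end

section \<open>Splitting off a cyclic summand\<close>

context finite_comm_groups
begin

lemma subgroup_image_pow:
  assumes "subgroup V P"
  shows "subgroup ((\<lambda>v. v [^]\<^bsub>P\<^esub> (n::nat)) ` V) P"
proof
  note c = subgroup.mem_carrier[OF assms]
  show "(\<lambda>v. v [^]\<^bsub>P\<^esub> n) ` V \<subseteq> carrier P"
    using c by auto
  fix x y assume "x \<in> (\<lambda>v. v [^]\<^bsub>P\<^esub> n) ` V" "y \<in> (\<lambda>v. v [^]\<^bsub>P\<^esub> n) ` V"
  then obtain u v where uv: "u \<in> V" "v \<in> V" "x = u [^]\<^bsub>P\<^esub> n" "y = v [^]\<^bsub>P\<^esub> n"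
    by blast
  have "x \<otimes>\<^bsub>P\<^esub> y = (u \<otimes>\<^bsub>P\<^esub> v) [^]\<^bsub>P\<^esub> n" "inv\<^bsub>P\<^esub> x = (inv\<^bsub>P\<^esub> u) [^]\<^bsub>P\<^esub> n"
    using uv c by (simp_all add: P.nat_pow_distrib P.nat_pow_inv)
  then show "x \<otimes>\<^bsub>P\<^esub> y \<in> (\<lambda>v. v [^]\<^bsub>P\<^esub> n) ` V" "inv\<^bsub>P\<^esub> x \<in> (\<lambda>v. v [^]\<^bsub>P\<^esub> n) ` V"
    using uv subgroup.m_closed[OF assms] subgroup.m_inv_closed[OF assms] by auto
next
  show "\<one>\<^bsub>P\<^esub> \<in> (\<lambda>v. v [^]\<^bsub>P\<^esub> n) ` V"
    using subgroup.one_closed[OF assms] by (auto intro!: image_eqI[of _ _ "\<one>\<^bsub>P\<^esub>"])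
qed

end

context controllable_group
begin

text \<open>Only finitely many subgroups of \<open>G\<close> lie above
  \<open>G \<inter> tail n\<close>, so maximal ones exist without Zorn's lemma.\<close>

lemma ex_maximal_open:
  assumes "\<And>S. S \<in> \<S> \<Longrightarrow> subgroup S P \<and> S \<subseteq> G \<and> G \<inter> tail n \<subseteq> S" "\<S> \<noteq> {}"
  shows "\<exists>M\<in>\<S>. \<forall>S\<in>\<S>. M \<subseteq> S \<longrightarrow> M = S"
proof -
  have "finite \<S>"
    by (rule finite_subset[OF _ finite_supergroups_tail[OF subgroup_G, of n]]) (use assms(1) in blast)
  then show ?thesis
    using finite_has_maximal[of \<S>] assms(2) by blast
qed

text \<open>For a subgroup \<open>S\<close> this is an internal direct decomposition of
  \<open>R\<close> with a cyclic \<open>p\<close>-group as second factor. The case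
  \<open>w = \<one>\<close> is allowed, so that a sequence of splittings can go on after the
  remainder has become trivial.\<close>

definition cyclic_split :: "(nat \<Rightarrow> 'a) set \<Rightarrow> nat \<Rightarrow> (nat \<Rightarrow> 'a) \<Rightarrow> (nat \<Rightarrow> 'a) set \<Rightarrow> bool" where
  "cyclic_split R p w S \<longleftrightarrow> Factorial_Ring.prime p \<and> w \<in> G \<inter> fin_supp Gs \<and>
     (\<exists>e. w [^]\<^bsub>P\<^esub> (p ^ e) = \<one>\<^bsub>P\<^esub>) \<and>
     S \<inter> generate P {w} = {\<one>\<^bsub>P\<^esub>} \<and> S <#>\<^bsub>P\<^esub> generate P {w} = R"

text \<open>Openness is meant relative to \<open>G\<close>, where the sets
  \<open>G \<inter> tail n\<close> form a neighbourhood base at the identity.\<close>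

definition open_subgroup :: "(nat \<Rightarrow> 'a) set \<Rightarrow> bool" where
  "open_subgroup R \<longleftrightarrow> subgroup R P \<and> R \<subseteq> G \<and> (\<exists>n. G \<inter> tail n \<subseteq> R)"

text \<open>The strict decrease of the projections is what later yields convergence. It comes from
  \<open>w\<close> being outside \<open>V\<close> while \<open>S\<close> is inside \<open>V\<close>:
  since \<open>V\<close> contains \<open>R \<inter> tail i\<close>, no element of \<open>S\<close>
  agrees with \<open>w\<close> up to \<open>i\<close>.\<close>

lemma splitting_step:
  assumes R: "open_subgroup R" and nR: "\<not> R \<subseteq> tail i"
  obtains p w S where "cyclic_split R p w S" "open_subgroup S" "S \<subseteq> R"
    "(\<lambda>x. restrict x {1..i}) ` S \<subset> (\<lambda>x. restrict x {1..i}) ` R"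
proof -
  have Rs: "subgroup R P" "R \<subseteq> G"
    using R by (auto simp: open_subgroup_def)
  obtain n0 where n0: "G \<inter> tail n0 \<subseteq> R"
    using R by (auto simp: open_subgroup_def)
  note Rc = subgroup.mem_carrier[OF Rs(1)]
  \<comment> \<open>Up to this bound both \<open>R\<close> and the subgroup \<open>V\<close> below
    are visible: an element of \<open>G\<close> that agrees up to \<open>m0\<close> with an element
    of \<open>R - V\<close> is again in \<open>R - V\<close>.\<close>
  define m0 where "m0 = max n0 i"
  have m0: "G \<inter> tail m0 \<subseteq> R" "G \<inter> tail m0 \<subseteq> R \<inter> tail i"
    using n0 tail_mono[of n0 m0] tail_mono[of i m0] unfolding m0_def by auto
  let ?V = "{V. subgroup V P \<and> V \<subset> R \<and> R \<inter> tail i \<subseteq> V}"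
  have "\<exists>V\<in>?V. \<forall>S\<in>?V. V \<subseteq> S \<longrightarrow> V = S"
  proof (rule ex_maximal_open)
    show "subgroup S P \<and> S \<subseteq> G \<and> G \<inter> tail m0 \<subseteq> S"
      if "S \<in> ?V" for S
      using that m0 Rs(2) by blast
    have "subgroup (R \<inter> tail i) P"
      using P.subgroups_Inter_pair[OF Rs(1) subgroup_tail] .
    moreover have "R \<inter> tail i \<subset> R"
      using nR by blast
    ultimately show "?V \<noteq> {}"
      by blast
  qed
  then obtain V where V: "V \<in> ?V" "\<forall>S\<in>?V. V \<subseteq> S \<longrightarrow> V = S"
    by (rule bexE)
  then have Vs: "subgroup V P" "V \<subset> R" "V \<subseteq> R" "R \<inter> tail i \<subseteq> V"
    and Vm: "\<And>S. subgroup S P \<Longrightarrow> S \<subset> R \<Longrightarrow> R \<inter> tail i \<subseteq> S \<Longrightarrow> V \<subseteq> S \<Longrightarrow> V = S"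
    by (simp_all add: psubset_imp_subset)
  have Vt: "G \<inter> tail m0 \<subseteq> V"
    using m0 Vs(4) by blast
  have Vmax: "R \<subseteq> V <#>\<^bsub>P\<^esub> generate P {r}" if r: "r \<in> R - V" for r
  proof -
    have rc: "r \<in> carrier P" using r Rc by simp
    have "V <#>\<^bsub>P\<^esub> generate P {r} \<subseteq> R"
      using P.adjoin_subset[OF Rs(1) Vs(3)] r by simp
    moreover have "V \<noteq> V <#>\<^bsub>P\<^esub> generate P {r}"
      using P.subgroup_adjoin(3)[OF Vs(1) rc] r by blast
    ultimately show ?thesis
      using Vm[of "V <#>\<^bsub>P\<^esub> generate P {r}"] P.subgroup_adjoin[OF Vs(1) rc] Vs(4) by blast
  qed
  obtain y0 where y0: "y0 \<in> R" "y0 \<notin> V"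
    using Vs(2) by blast
  obtain N :: nat where N: "N > 0" "\<forall>x\<in>carrier P. \<forall>j\<in>{1..i}. x j [^]\<^bsub>Gs j\<^esub> N = \<one>\<^bsub>Gs j\<^esub>"
    using torsion_coords by blast
  have "y0 [^]\<^bsub>P\<^esub> N \<in> tail i"
    using Rc[OF y0(1)] N(2) by (auto simp: tail_def agree_def coord_simps)
  then have "y0 [^]\<^bsub>P\<^esub> N \<in> V"
    using P.subgroup_nat_pow_closed[OF Rs(1) y0(1)] Vs(4) by blast
  then obtain p t :: nat where p: "Factorial_Ring.prime p"
    and y1: "y0 [^]\<^bsub>P\<^esub> t \<notin> V" "(y0 [^]\<^bsub>P\<^esub> t) [^]\<^bsub>P\<^esub> p \<in> V"
    using P.prime_pow_in_subgroup[OF Vs(1) Rc[OF y0(1)] y0(2) _ N(1)] by blast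
  define y where "y = y0 [^]\<^bsub>P\<^esub> t"
  have y: "y \<in> R" "y \<notin> V" "y [^]\<^bsub>P\<^esub> p \<in> V"
    using y1 P.subgroup_nat_pow_closed[OF Rs(1) y0(1)] unfolding y_def by auto
  have yc: "y \<in> carrier P" using Rc y(1) .
  \<comment> \<open>The quotient of \<open>R\<close> by \<open>V\<close> is generated by the image
    of \<open>y\<close>, and \<open>y [^] p\<close> lies in \<open>V\<close>.\<close>
  have pV: "r [^]\<^bsub>P\<^esub> p \<in> V" if r: "r \<in> R" for r
  proof -
    obtain v and d :: int where vd: "v \<in> V" "r = v \<otimes>\<^bsub>P\<^esub> y [^]\<^bsub>P\<^esub> d"
      using Vmax[of y] y r P.mem_adjoin_iff[OF yc] by blast
    have vc: "v \<in> carrier P" using subgroup.mem_carrier[OF Vs(1) vd(1)] .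
    have "r [^]\<^bsub>P\<^esub> p = v [^]\<^bsub>P\<^esub> p \<otimes>\<^bsub>P\<^esub> (y [^]\<^bsub>P\<^esub> p) [^]\<^bsub>P\<^esub> d"
      using vd(2) vc yc by (simp add: P.int_pow_distrib P.int_pow_pow mult.commute flip: int_pow_int)
    then show ?thesis
      using subgroup.m_closed[OF Vs(1)] P.subgroup_nat_pow_closed[OF Vs(1) vd(1)]
        P.subgroup_int_pow_closed[OF Vs(1) y(3)] by simp
  qed
  have approx_R: "a \<in> R - V" if "a \<in> G" "x \<in> R - V" "agree m0 a x" for a x
  proof -
    have "a \<in> R"
      using mem_if_agree[OF subgroup_G Rs m0(1)] that by blast
    moreover have "x \<in> G"
      using that(2) Rs(2) by blast
    ultimately show ?thesis
      using mem_if_agree[OF subgroup_G Vs(1) _ Vt _ _ agree_sym[OF that(3)]] that(2) Vs(3) Rs(2)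
      by blast
  qed
  obtain n1 where n1: "\<And>c. c \<in> G \<Longrightarrow> \<exists>a \<in> G \<inter> fin_supp Gs. agree m0 a c \<and>
     (\<forall>N::nat. (\<forall>j\<in>{1..n1}. c j [^]\<^bsub>Gs j\<^esub> N = \<one>\<^bsub>Gs j\<^esub>) \<longrightarrow> a [^]\<^bsub>P\<^esub> N = \<one>\<^bsub>P\<^esub>)"
    using controllable_approx[of m0] by blast
  let ?E = "\<lambda>e. \<exists>x\<in>R - V. x [^]\<^bsub>P\<^esub> (p ^ e) = \<one>\<^bsub>P\<^esub>"
  have "\<exists>e. ?E e"
  proof -
    obtain a where a: "a \<in> G \<inter> fin_supp Gs" "agree m0 a y"
      using n1[of y] y(1) Rs(2) by blast
    then have aRV: "a \<in> R - V"
      using approx_R y by blast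
    obtain N :: nat where N: "N > 0" "a [^]\<^bsub>P\<^esub> N = \<one>\<^bsub>P\<^esub>"
      using fin_supp_torsion a(1) by blast
    \<comment> \<open>The part \<open>N'\<close> of the order bound that is prime to
      \<open>p\<close> is removed by passing to the \<open>N'\<close>-th power. This stays outside
      \<open>V\<close>, because \<open>V\<close> contains the \<open>p\<close>-th power of
      \<open>a\<close>.\<close>
    have "N \<noteq> 0" "\<not> is_unit p"
      using N(1) p by auto
    then obtain N' where N': "N = p ^ multiplicity p N * N'" "\<not> p dvd N'"
      using multiplicity_decompose' by blast
    have ac: "a \<in> carrier P" using aRV Rc by blast
    have "a [^]\<^bsub>P\<^esub> N' \<notin> V"
    proof
      assume "a [^]\<^bsub>P\<^esub> N' \<in> V"
      moreover have "coprime (int p) (int N')"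
        using p N'(2) prime_imp_coprime[of p N'] by simp
      moreover have "a [^]\<^bsub>P\<^esub> p \<in> V"
        using pV aRV by blast
      ultimately have "a \<in> V"
        using P.subgroup_coprime_pow[OF Vs(1) ac, of "int p" "int N'"] by (simp add: int_pow_int)
      then show False using aRV by blast
    qed
    moreover have "a [^]\<^bsub>P\<^esub> N' \<in> R"
      using P.subgroup_nat_pow_closed[OF Rs(1)] aRV by blast
    moreover have "(a [^]\<^bsub>P\<^esub> N') [^]\<^bsub>P\<^esub> (p ^ multiplicity p N) = \<one>\<^bsub>P\<^esub>"
      using ac N(2) N'(1) by (simp add: P.nat_pow_pow mult.commute)
    ultimately show ?thesis by blast
  qed
  define e0 where "e0 = (LEAST e. ?E e)"
  have e0: "?E e0"
    unfolding e0_def using \<open>\<exists>e. ?E e\<close> by (rule LeastI_ex)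
  have "e0 \<noteq> 0"
  proof
    assume "e0 = 0"
    then obtain x where "x \<in> R - V" "x [^]\<^bsub>P\<^esub> (1::nat) = \<one>\<^bsub>P\<^esub>"
      using e0 by auto
    then show False
      using Rc subgroup.one_closed[OF Vs(1)] by auto
  qed
  then obtain k where k: "e0 = Suc k"
    using not0_implies_Suc by blast
  have minimal: "x [^]\<^bsub>P\<^esub> (p ^ k) \<noteq> \<one>\<^bsub>P\<^esub>" if "x \<in> R - V" for x
    using not_less_Least[of k ?E] that k unfolding e0_def by auto
  obtain x where x: "x \<in> R - V" "x [^]\<^bsub>P\<^esub> (p ^ Suc k) = \<one>\<^bsub>P\<^esub>"
    using e0 k by blast
  have xc: "x \<in> carrier P" using Rc x(1) by blast
  \<comment> \<open>Order controllability carries the exponent \<open>p ^ Suc k\<close> of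
    \<open>x\<close> over to an element of finite support, which is still in \<open>R - V\<close>
    because it agrees with \<open>x\<close> up to \<open>m0\<close>.\<close>
  obtain w where w: "w \<in> G \<inter> fin_supp Gs" "agree m0 w x" "w [^]\<^bsub>P\<^esub> (p ^ Suc k) = \<one>\<^bsub>P\<^esub>"
  proof -
    have "x j [^]\<^bsub>Gs j\<^esub> (p ^ Suc k) = \<one>\<^bsub>Gs j\<^esub>" if "j \<in> {1..n1}" for j
      using that arg_cong[OF x(2), of "\<lambda>z. z j"] by (simp add: coord_simps del: power_Suc)
    then show thesis
      using n1[of x] x(1) Rs(2) that by blast
  qed
  have wRV: "w \<in> R - V"
    using approx_R[of w x] w x by blast
  have wc: "w \<in> carrier P" using Rc wRV by blast
  define z where "z = w [^]\<^bsub>P\<^esub> (p ^ k)"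
  \<comment> \<open>If \<open>z\<close> agreed with the power of some \<open>v \<in> V\<close> up to \<open>n1\<close>, order controllability applied to
    \<open>w v\<^sup>-\<^sup>1\<close> would yield an element of \<open>R - V\<close> of order at most \<open>p^k\<close>.\<close>
  have not_agree: "\<not> agree n1 z (v [^]\<^bsub>P\<^esub> (p ^ k))" if v: "v \<in> V" for v
  proof
    assume ag: "agree n1 z (v [^]\<^bsub>P\<^esub> (p ^ k))"
    define u where "u = w \<otimes>\<^bsub>P\<^esub> inv\<^bsub>P\<^esub> v"
    have vR: "v \<in> R" and vc: "v \<in> carrier P"
      using v Vs(3) Rc by auto
    have uR: "u \<in> R"
      unfolding u_def using wRV vR subgroup.m_closed[OF Rs(1)] subgroup.m_inv_closed[OF Rs(1)] by blast
    have "u \<notin> V"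
    proof
      assume "u \<in> V"
      then have "u \<otimes>\<^bsub>P\<^esub> v \<in> V"
        using v subgroup.m_closed[OF Vs(1)] by blast
      then show False
        using wRV wc vc unfolding u_def by (simp add: P.m_assoc)
    qed
    have "u [^]\<^bsub>P\<^esub> (p ^ k) = z \<otimes>\<^bsub>P\<^esub> inv\<^bsub>P\<^esub> (v [^]\<^bsub>P\<^esub> (p ^ k))"
      unfolding u_def z_def using wc vc by (simp add: P.nat_pow_distrib P.nat_pow_inv)
    then have "u [^]\<^bsub>P\<^esub> (p ^ k) \<in> tail n1"
      using ag agree_iff_tail[of z "v [^]\<^bsub>P\<^esub> (p ^ k)" n1] wc vc unfolding z_def by simp
    then have "\<forall>j\<in>{1..n1}. u j [^]\<^bsub>Gs j\<^esub> (p ^ k) = \<one>\<^bsub>Gs j\<^esub>"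
      by (simp add: tail_def agree_def coord_simps)
    then obtain a where "a \<in> G" "agree m0 a u" "a [^]\<^bsub>P\<^esub> (p ^ k) = \<one>\<^bsub>P\<^esub>"
      using n1[of u] uR Rs(2) by blast
    then show False
      using approx_R[of a u] minimal uR \<open>u \<notin> V\<close> by blast
  qed
  \<comment> \<open>\<open>B\<close> enlarges the group of \<open>p ^ k\<close>-th powers of
    \<open>V\<close> to an open subgroup, so that \<open>ex_maximal_open\<close> applies to the
    subgroups above it. \<open>m\<close> is at least \<open>n1\<close> so that
    \<open>not_agree\<close> keeps \<open>z\<close> out of \<open>B\<close>, and at least
    \<open>m0\<close> so that \<open>B\<close> stays in \<open>R\<close>.\<close>
  define m where "m = max n1 m0"
  define B where "B = (\<lambda>v. v [^]\<^bsub>P\<^esub> (p ^ k)) ` V <#>\<^bsub>P\<^esub> (G \<inter> tail m)"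
  have subW: "subgroup (G \<inter> tail m) P"
    using P.subgroups_Inter_pair[OF subgroup_G subgroup_tail] .
  have Bs: "subgroup B P"
    unfolding B_def by (rule P.mult_subgroups[OF subgroup_image_pow[OF Vs(1)] subW])
  have mem_B: "b \<in> B \<longleftrightarrow> (\<exists>v\<in>V. \<exists>s\<in>G \<inter> tail m. b = v [^]\<^bsub>P\<^esub> (p ^ k) \<otimes>\<^bsub>P\<^esub> s)" for b
    unfolding B_def set_mult_def by auto
  have VB: "v [^]\<^bsub>P\<^esub> (p ^ k) \<in> B" if "v \<in> V" for v
    unfolding mem_B using that subgroup.one_closed[OF subW] subgroup.mem_carrier[OF Vs(1) that]
    by (intro bexI[of _ v] bexI[of _ "\<one>\<^bsub>P\<^esub>"]) auto
  have WB: "G \<inter> tail m \<subseteq> B"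
  proof
    fix s assume s: "s \<in> G \<inter> tail m"
    then have "s \<in> carrier P" using G_carrier by blast
    then show "s \<in> B"
      unfolding mem_B using s subgroup.one_closed[OF Vs(1)]
      by (intro bexI[of _ "\<one>\<^bsub>P\<^esub>"] bexI[of _ s]) auto
  qed
  have "G \<inter> tail m \<subseteq> R"
    using m0(1) tail_mono[of m0 m] unfolding m_def by auto
  then have BR: "B \<subseteq> R"
    unfolding subset_iff mem_B
    using P.subgroup_nat_pow_closed[OF Rs(1)] subgroup.m_closed[OF Rs(1)] Vs(3) by blast
  have zB: "z \<notin> B"
  proof
    assume "z \<in> B"
    then obtain v s where vs: "v \<in> V" "s \<in> tail m" "z = v [^]\<^bsub>P\<^esub> (p ^ k) \<otimes>\<^bsub>P\<^esub> s"
      unfolding mem_B by blast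
    have vc: "v [^]\<^bsub>P\<^esub> (p ^ k) \<in> carrier P"
      using subgroup.mem_carrier[OF Vs(1) vs(1)] by simp
    have "agree m z (v [^]\<^bsub>P\<^esub> (p ^ k) \<otimes>\<^bsub>P\<^esub> \<one>\<^bsub>P\<^esub>)"
      unfolding vs(3) using vs(2) by (intro agree_mult) (auto simp: tail_def agree_def)
    then have "agree n1 z (v [^]\<^bsub>P\<^esub> (p ^ k))"
      using vc agree_mono[of m _ _ n1] unfolding m_def by simp
    then show False
      using not_agree vs(1) by blast
  qed
  let ?S = "{S. subgroup S P \<and> S \<subseteq> R \<and> B \<subseteq> S \<and> z \<notin> S}"
  have "\<exists>S\<in>?S. \<forall>T\<in>?S. S \<subseteq> T \<longrightarrow> S = T"
  proof (rule ex_maximal_open)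
    show "subgroup S P \<and> S \<subseteq> G \<and> G \<inter> tail m \<subseteq> S"
      if "S \<in> ?S" for S
      using that WB Rs(2) by blast
    show "?S \<noteq> {}"
      using Bs BR zB by blast
  qed
  then obtain S where S: "S \<in> ?S" "\<forall>T\<in>?S. S \<subseteq> T \<longrightarrow> S = T"
    by (rule bexE)
  then have Ss: "subgroup S P" "S \<subseteq> R" "B \<subseteq> S" "z \<notin> S"
    and Sm: "\<And>T. subgroup T P \<Longrightarrow> T \<subseteq> R \<Longrightarrow> B \<subseteq> T \<Longrightarrow> z \<notin> T \<Longrightarrow> S \<subseteq> T \<Longrightarrow> S = T"
    by (simp_all add: psubset_imp_subset)
  have split: "S \<subseteq> V" "S \<inter> generate P {w} = {\<one>\<^bsub>P\<^esub>}" "S <#>\<^bsub>P\<^esub> generate P {w} = R"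
  proof -
    have pk: "v [^]\<^bsub>P\<^esub> (p ^ k) \<in> S" if "v \<in> V" for v
      using VB[OF that] Ss(3) by blast
    have tors: "\<exists>n>0. r [^]\<^bsub>P\<^esub> (n::nat) \<in> S" if r: "r \<in> R" for r
    proof -
      obtain N :: nat where N: "N > 0" "\<forall>x\<in>carrier P. \<forall>j\<in>{1..m}. x j [^]\<^bsub>Gs j\<^esub> N = \<one>\<^bsub>Gs j\<^esub>"
        using torsion_coords by blast
      have "r [^]\<^bsub>P\<^esub> N \<in> tail m"
        using Rc[OF r] N(2) by (auto simp: tail_def agree_def coord_simps)
      then have "r [^]\<^bsub>P\<^esub> N \<in> S"
        using P.subgroup_nat_pow_closed[OF Rs(1) r] Rs(2) WB Ss(3) by blast
      then show ?thesis using N(1) by blast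
    qed
    have zmax: "w [^]\<^bsub>P\<^esub> (p ^ k) \<in> T" if "subgroup T P" "S \<subset> T" "T \<subseteq> R" for T
      using Sm[of T] that Ss(3) unfolding z_def by blast
    have wR: "w \<in> R" using wRV by blast
    \<comment> \<open>Here \<open>S\<close> takes the place of \<open>R'\<close>, and
      \<open>w\<close> that of \<open>x\<close>.\<close>
    note cs = P.cyclic_splitting[OF Rs(1) Vs(1,3) Vmax p wR w(3) pV Ss(1,2) pk Ss(4)[unfolded z_def] tors zmax]
    show "S \<subseteq> V" "S \<inter> generate P {w} = {\<one>\<^bsub>P\<^esub>}" "S <#>\<^bsub>P\<^esub> generate P {w} = R"
      using cs by auto
  qed
  have "open_subgroup S"
    using Ss WB Rs(2) unfolding open_subgroup_def by blast
  moreover have "cyclic_split R p w S"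
    unfolding cyclic_split_def using p w split by blast
  moreover have "(\<lambda>x. restrict x {1..i}) ` S \<subset> (\<lambda>x. restrict x {1..i}) ` R"
  proof -
    have "restrict w {1..i} \<notin> (\<lambda>x. restrict x {1..i}) ` S"
    proof
      assume "restrict w {1..i} \<in> (\<lambda>x. restrict x {1..i}) ` S"
      then obtain s where s: "s \<in> S" "restrict w {1..i} = restrict s {1..i}"
        by auto
      have ag: "agree i w s"
        unfolding agree_def
      proof
        fix j assume "j \<in> {1..i}"
        then show "w j = s j"
          using fun_cong[OF s(2), of j] by simp
      qed
      have "w \<in> V"
        by (rule mem_if_agree[OF Rs(1) Vs(1,3,4) _ _ ag]) (use wRV s split(1) in auto)
      then show False using wRV by blast
    qed
    then show ?thesis using Ss(2) wRV by blast
  qed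
  ultimately show thesis
    using that Ss(2) by blast
qed

end

section \<open>Infinite sums\<close>

context finite_comm_groups
begin

lemma comm_monoid_factor: "i \<ge> 1 \<Longrightarrow> comm_monoid (Gs i)"
  using comm_factor by (simp add: comm_group_def)

lemma coord_finprod:
  assumes "finite F" "x \<in> F \<rightarrow> carrier P" "i \<ge> 1"
  shows "finprod P x F i = finprod (Gs i) (\<lambda>n. x n i) F"
  using assms(1,2)
proof (induction F rule: finite_induct)
  case empty
  then show ?case
    using assms(3) comm_monoid_factor[OF assms(3)] by (simp add: coord_simps comm_monoid.finprod_empty)
next
  case (insert a F)
  have "(\<lambda>n. x n i) \<in> F \<rightarrow> carrier (Gs i)" "x a i \<in> carrier (Gs i)"
    using insert.prems coord_closed assms(3) by auto
  then show ?case
    using insert assms(3) comm_monoid_factor[OF assms(3)]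
    by (simp add: coord_simps comm_monoid.finprod_insert)
qed

text \<open>
  The sum is taken coordinatewise; it is meaningful for null families only, because
  \<^const>\<open>gfinprod\<close> of infinitely many nontrivial terms is \<open>\<one>\<close>.
\<close>

definition inf_sum :: "'l set \<Rightarrow> ('l \<Rightarrow> nat \<Rightarrow> 'a) \<Rightarrow> nat \<Rightarrow> 'a" where
  "inf_sum L x = (\<lambda>i\<in>{1..}. gfinprod (Gs i) (\<lambda>n. x n i) L)"

text \<open>This is convergence to the identity along the cofinite sets of indices: each
  \<open>tail i\<close> contains all but finitely many members.\<close>

definition null_family :: "'l set \<Rightarrow> ('l \<Rightarrow> nat \<Rightarrow> 'a) \<Rightarrow> bool" where
  "null_family L x \<longleftrightarrow> x \<in> L \<rightarrow> carrier P \<and> (\<forall>i. finite {n \<in> L. \<not> agree i (x n) \<one>\<^bsub>P\<^esub>})"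

lemma null_family_finite:
  assumes "null_family L x" "i \<ge> 1"
  shows "finite {n \<in> L. x n i \<noteq> \<one>\<^bsub>Gs i\<^esub>}" "(\<lambda>n. x n i) \<in> L \<rightarrow> carrier (Gs i)"
proof -
  have "{n \<in> L. x n i \<noteq> \<one>\<^bsub>Gs i\<^esub>} \<subseteq> {n \<in> L. \<not> agree i (x n) \<one>\<^bsub>P\<^esub>}"
    using assms(2) by (auto simp: agree_def coord_simps)
  then show "finite {n \<in> L. x n i \<noteq> \<one>\<^bsub>Gs i\<^esub>}"
    using assms(1) finite_subset unfolding null_family_def by blast
  show "(\<lambda>n. x n i) \<in> L \<rightarrow> carrier (Gs i)"
    using assms coord_closed by (auto simp: null_family_def)
qed

lemma inf_sum_closed:
  assumes "x \<in> L \<rightarrow> carrier P"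
  shows "inf_sum L x \<in> carrier P"
  unfolding carrier_product_group
proof
  fix i :: nat assume "i \<in> {1..}"
  then have i: "i \<ge> 1" by simp
  have "(\<lambda>n. x n i) \<in> L \<rightarrow> carrier (Gs i)"
    using assms coord_closed[OF _ i] by auto
  then show "inf_sum L x i \<in> carrier (Gs i)"
    using i comm_monoid.gfinprod_closed[OF comm_monoid_factor[OF i]] by (simp add: inf_sum_def)
qed (simp add: inf_sum_def)

lemma inf_sum_mult:
  assumes "null_family L x" "null_family L y"
  shows "inf_sum L (\<lambda>n. x n \<otimes>\<^bsub>P\<^esub> y n) = inf_sum L x \<otimes>\<^bsub>P\<^esub> inf_sum L y"
proof (rule P_eqI)
  have xy: "x \<in> L \<rightarrow> carrier P" "y \<in> L \<rightarrow> carrier P"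
    using assms by (auto simp: null_family_def)
  show "inf_sum L (\<lambda>n. x n \<otimes>\<^bsub>P\<^esub> y n) \<in> carrier P" "inf_sum L x \<otimes>\<^bsub>P\<^esub> inf_sum L y \<in> carrier P"
    using xy by (auto intro!: inf_sum_closed P.m_closed)
  fix i :: nat assume i: "i \<ge> 1"
  show "inf_sum L (\<lambda>n. x n \<otimes>\<^bsub>P\<^esub> y n) i = (inf_sum L x \<otimes>\<^bsub>P\<^esub> inf_sum L y) i"
    using comm_monoid.gfinprod_distrib[OF comm_monoid_factor[OF i]
        null_family_finite(1)[OF assms(1) i] null_family_finite(1)[OF assms(2) i]
        null_family_finite(2)[OF assms(1) i] null_family_finite(2)[OF assms(2) i]] i
    by (simp add: inf_sum_def coord_simps)
qed

lemma inf_sum_cong: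
  assumes "x \<in> L \<rightarrow> carrier P" "\<And>n. n \<in> L \<Longrightarrow> x n = y n"
  shows "inf_sum L x = inf_sum L y"
  unfolding inf_sum_def
proof (rule restrict_ext)
  fix i :: nat assume "i \<in> {1..}"
  then have i: "i \<ge> 1" by simp
  have "y n i \<in> carrier (Gs i)" if "n \<in> L" for n
    using assms(1) assms(2)[OF that, symmetric] that coord_closed[OF _ i] by auto
  then have "(\<lambda>n. y n i) \<in> L \<rightarrow> carrier (Gs i)"
    by simp
  then show "gfinprod (Gs i) (\<lambda>n. x n i) L = gfinprod (Gs i) (\<lambda>n. y n i) L"
    using assms(2) by (intro comm_monoid.gfinprod_cong[OF comm_monoid_factor[OF i]]) (auto simp: simp_implies_def)
qed

text \<open>Outside \<open>F\<close> every term contributes only identities to the first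
  \<open>i\<close> coordinates. Comparisons of infinite sums are reduced to finite products of
  \<open>P\<close> in this way.\<close>

lemma agree_inf_sum:
  assumes "x \<in> L \<rightarrow> carrier P" "finite F" "F \<subseteq> L"
    and F: "\<And>n. n \<in> L - F \<Longrightarrow> agree i (x n) \<one>\<^bsub>P\<^esub>"
  shows "agree i (inf_sum L x) (finprod P x F)"
  unfolding agree_def
proof
  fix j assume "j \<in> {1..i}"
  then have j: "j \<ge> 1" "j \<le> i" by auto
  have c: "(\<lambda>n. x n j) \<in> L \<rightarrow> carrier (Gs j)"
    using assms(1) coord_closed[OF _ j(1)] by auto
  have xF: "x \<in> F \<rightarrow> carrier P" "(\<lambda>n. x n j) \<in> F \<rightarrow> carrier (Gs j)"
    using assms(1,3) c by auto
  have "gfinprod (Gs j) (\<lambda>n. x n j) L = gfinprod (Gs j) (\<lambda>n. x n j) F"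
    using F j c assms(3)
    by (intro comm_monoid.gfinprod_mono_neutral_cong_right[OF comm_monoid_factor[OF j(1)]])
      (auto simp: agree_def coord_simps)
  also have "\<dots> = finprod (Gs j) (\<lambda>n. x n j) F"
    using comm_monoid.gfinprod_eq_finprod[OF comm_monoid_factor[OF j(1)] assms(2) xF(2)] .
  also have "\<dots> = finprod P x F j"
    using coord_finprod[OF assms(2) xF(1) j(1)] by simp
  finally show "inf_sum L x j = finprod P x F j"
    using j by (simp add: inf_sum_def)
qed

text \<open>Links the coordinatewise sum with the summation used for \<open>ext_sum\<close>. The
  finiteness assumption keeps \<open>gfinprod\<close> in \<open>P\<close> away from its default
  value \<open>\<one>\<close>.\<close>

lemma inf_sum_eq_gfinprod:
  assumes x: "x \<in> L \<rightarrow> carrier P" and fin: "finite {n \<in> L. x n \<noteq> \<one>\<^bsub>P\<^esub>}"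
  shows "inf_sum L x = gfinprod P x L"
proof (rule P_eqI)
  show "inf_sum L x \<in> carrier P"
    using x by (rule inf_sum_closed)
  show "gfinprod P x L \<in> carrier P"
    using x by (rule P.gfinprod_closed)
  fix i :: nat assume i: "i \<ge> 1"
  have "agree i (inf_sum L x) (finprod P x {n \<in> L. x n \<noteq> \<one>\<^bsub>P\<^esub>})"
    using x fin by (intro agree_inf_sum) (auto simp: agree_def)
  then show "inf_sum L x i = gfinprod P x L i"
    using fin i by (simp add: gfinprod_def agree_def)
qed

lemma agreeD_eq:
  assumes "x \<in> carrier P" "y \<in> carrier P" "\<And>i. agree i x y"
  shows "x = y"
  using assms(1,2)
proof (rule P_eqI)
  fix i :: nat assume "i \<ge> 1"
  then show "x i = y i"
    using assms(3)[of i] by (simp add: agree_def)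
qed

lemma finprod_in_subgroup:
  assumes "subgroup H P" "finite F" "x \<in> F \<rightarrow> H"
  shows "finprod P x F \<in> H"
  using assms(2,3)
proof (induction F rule: finite_induct)
  case empty
  then show ?case using subgroup.one_closed[OF assms(1)] by simp
next
  case (insert a F)
  have "x \<in> F \<rightarrow> carrier P" "x a \<in> carrier P"
    using insert.prems subgroup.mem_carrier[OF assms(1)] by auto
  then show ?case
    using insert subgroup.m_closed[OF assms(1)] by (simp add: P.finprod_insert)
qed

section \<open>Closure in the product topology\<close>

lemma topspace_prod_top: "topspace (prod_top Gs) = carrier P"
  by (simp add: prod_top_def carrier_product_group)

text \<open>A basic open set restricts finitely many coordinates, hence only coordinates up to some
  \<open>i\<close>; conversely, fixing the first \<open>i\<close> coordinates is open because the
  factors are discrete.\<close>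

lemma in_closure_prod_top:
  "x \<in> prod_top Gs closure_of S \<longleftrightarrow> x \<in> carrier P \<and> (\<forall>i. \<exists>s\<in>S \<inter> carrier P. agree i s x)"
proof (intro iffI conjI allI)
  assume x: "x \<in> prod_top Gs closure_of S"
  then show xc: "x \<in> carrier P"
    using topspace_prod_top by (simp add: in_closure_of)
  fix i
  let ?U = "PiE {1..} (\<lambda>j. if j \<le> i then {x j} else carrier (Gs j))"
  have "openin (prod_top Gs) ?U"
    unfolding prod_top_def
  proof (rule openin_PiE_gen[THEN iffD2], intro disjI2 conjI ballI)
    show "finite {j \<in> {1..}. (if j \<le> i then {x j} else carrier (Gs j)) \<noteq>
        topspace (discrete_topology (carrier (Gs j)))}"
      by (rule finite_subset[of _ "{..i}"]) auto
  qed (use coord_closed[OF xc] in auto)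
  moreover have "x \<in> ?U"
    using xc by (auto simp: carrier_product_group PiE_iff)
  ultimately obtain s where s: "s \<in> S" "s \<in> ?U"
    using x by (auto simp: in_closure_of)
  have "s j \<in> carrier (Gs j)" if "j \<ge> 1" for j
    using PiE_mem[OF s(2), of j] coord_closed[OF xc that] that by (auto split: if_splits)
  then have "s \<in> PiE {1..} (\<lambda>j. carrier (Gs j))"
    using s(2) by (auto simp: PiE_iff)
  moreover have "agree i s x"
    using s(2) by (auto simp: agree_def PiE_iff split: if_splits)
  ultimately show "\<exists>s\<in>S \<inter> carrier P. agree i s x"
    using s(1) by (auto simp: carrier_product_group)
next
  assume x: "x \<in> carrier P \<and> (\<forall>i. \<exists>s\<in>S \<inter> carrier P. agree i s x)"
  show "x \<in> prod_top Gs closure_of S"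
    unfolding in_closure_of topspace_prod_top
  proof (intro conjI allI impI)
    show "x \<in> carrier P" using x by blast
    fix T assume T: "x \<in> T \<and> openin (prod_top Gs) T"
    then obtain U where U: "finite {j \<in> {1..}. U j \<noteq> carrier (Gs j)}" "x \<in> PiE {1..} U" "PiE {1..} U \<subseteq> T"
      unfolding prod_top_def openin_product_topology_alt by auto
    obtain i where i: "{j \<in> {1..}. U j \<noteq> carrier (Gs j)} \<subseteq> {..i}"
      using U(1) finite_nat_iff_bounded_le by blast
    obtain s where s: "s \<in> S" "s \<in> carrier P" "agree i s x"
      using x by blast
    have "s j \<in> U j" if "j \<ge> 1" for j
    proof (cases "j \<le> i")
      case True
      then show ?thesis
        using s(3) U(2) that by (auto simp: agree_def PiE_iff)
    next
      case False
      then have "U j = carrier (Gs j)"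
        using subsetD[OF i, of j] that by auto
      then show ?thesis using coord_closed[OF s(2) that] by simp
    qed
    then have "s \<in> PiE {1..} U"
      using s(2) by (auto simp: carrier_product_group PiE_iff)
    then show "\<exists>y. y \<in> S \<and> y \<in> T"
      using U(3) s(1) by blast
  qed
qed

end

section \<open>The sequence of successive splittings\<close>

context controllable_group
begin

lemma mem_G_if_agree:
  assumes "x \<in> carrier P" "\<And>i. \<exists>s\<in>G. agree i s x"
  shows "x \<in> G"
proof -
  have "x \<in> prod_top Gs closure_of G"
    unfolding in_closure_prod_top using assms G_carrier by blast
  then show ?thesis
    using closed_G by (simp add: closure_of_closedin)
qed

text \<open>This fills up the sequence of splittings once the remainder is trivial; the prime 2 is
  an arbitrary choice.\<close>

lemma cyclic_split_trivial:
  assumes "open_subgroup R"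
  shows "cyclic_split R 2 \<one>\<^bsub>P\<^esub> R"
proof -
  have R: "subgroup R P" using assms by (simp add: open_subgroup_def)
  have g: "generate P {\<one>\<^bsub>P\<^esub>} = {\<one>\<^bsub>P\<^esub>}"
    using P.generate_one by simp
  have "R <#>\<^bsub>P\<^esub> generate P {\<one>\<^bsub>P\<^esub>} = R"
    using P.adjoin_subset[OF R subset_refl subgroup.one_closed[OF R]]
      P.subgroup_adjoin(2)[OF R P.one_closed] by blast
  moreover have "R \<inter> generate P {\<one>\<^bsub>P\<^esub>} = {\<one>\<^bsub>P\<^esub>}"
    using g subgroup.one_closed[OF R] by auto
  ultimately show ?thesis
    unfolding cyclic_split_def
    using subgroup.one_closed[OF subgroup_G] subgroup.one_closed[OF subgroup_fin_supp]
    by (auto intro!: exI[of _ 0])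
qed

text \<open>Each step splits with respect to the least \<open>i\<close> for which the remainder is
  not inside \<open>tail i\<close>. The projection to the first \<open>i\<close> coordinates is
  finite and shrinks strictly each time, so only finitely many steps are spent on one
  \<open>i\<close>.\<close>

lemma splitting_sequence:
  obtains R :: "nat \<Rightarrow> (nat \<Rightarrow> 'a) set" and p w where
    "R 1 = G" "\<And>m. m \<ge> 1 \<Longrightarrow> open_subgroup (R m)"
    "\<And>m. m \<ge> 1 \<Longrightarrow> cyclic_split (R m) (p m) (w m) (R (Suc m))"
    "\<And>m n. 1 \<le> m \<Longrightarrow> m \<le> n \<Longrightarrow> R n \<subseteq> R m"
    "\<And>i. \<exists>m\<ge>1. R m \<subseteq> tail i"
proof -
  let ?img = "\<lambda>i S. (\<lambda>x. restrict x {1..i}) ` S"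
  \<comment> \<open>The last clause speaks of the least obstructed coordinate, if there is one; for
    a trivial remainder it is vacuous and the trivial splitting serves.\<close>
  let ?Q = "\<lambda>(n::nat) S S'. (\<exists>p w. cyclic_split S p w S') \<and> S' \<subseteq> S \<and>
      (\<forall>i. \<not> S \<subseteq> tail i \<and> (\<forall>j<i. S \<subseteq> tail j) \<longrightarrow> ?img i S' \<subset> ?img i S)"
  have open_G: "open_subgroup G"
    using subgroup_G by (auto simp: open_subgroup_def)
  have step: "\<exists>S'. (open_subgroup S' \<and> (Suc n = 0 \<longrightarrow> S' = G)) \<and> ?Q n S S'"
    if S: "open_subgroup S \<and> (n = 0 \<longrightarrow> S = G)" for S n
  proof (cases "\<exists>i. \<not> S \<subseteq> tail i")
    case True
    define i where "i = (LEAST i. \<not> S \<subseteq> tail i)"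
    have i: "\<not> S \<subseteq> tail i" "\<And>j. j < i \<Longrightarrow> S \<subseteq> tail j"
      using LeastI_ex[OF True] not_less_Least unfolding i_def by blast+
    obtain p w S' where S': "cyclic_split S p w S'" "open_subgroup S'" "S' \<subseteq> S" "?img i S' \<subset> ?img i S"
      using splitting_step[OF conjunct1[OF S] i(1)] by blast
    have "i' = i" if "\<not> S \<subseteq> tail i'" "\<forall>j<i'. S \<subseteq> tail j" for i'
      using that i by (metis nat_neq_iff)
    then have "?Q n S S'"
      using S' by blast
    then show ?thesis using S'(2) by blast
  next
    case False
    then have "?Q n S S"
      using cyclic_split_trivial S by blast
    then show ?thesis using S by blast
  qed
  have "\<exists>f. \<forall>n. (open_subgroup (f n) \<and> (n = 0 \<longrightarrow> f n = G)) \<and> ?Q n (f n) (f (Suc n))"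
  proof (rule dependent_nat_choice[of "\<lambda>n S. open_subgroup S \<and> (n = 0 \<longrightarrow> S = G)" ?Q])
    show "\<exists>S. open_subgroup S \<and> (0 = (0::nat) \<longrightarrow> S = G)"
      using open_G by blast
  qed (rule step)
  then obtain f where f0: "\<forall>n. (open_subgroup (f n) \<and> (n = 0 \<longrightarrow> f n = G)) \<and> ?Q n (f n) (f (Suc n))"
    by (rule exE)
  note f = conjunct1[OF spec[OF f0]] conjunct2[OF spec[OF f0]]
  have dec: "f n \<subseteq> f m" if "m \<le> n" for m n
    using that f(2) by (induction rule: dec_induct) auto
  have fG: "f n \<subseteq> G" for n
    using f(1)[of n] by (simp add: open_subgroup_def)
  have fin: "finite (?img i (f n))" for i n
  proof (rule finite_subset)
    show "?img i (f n) \<subseteq> PiE {1..i} (\<lambda>i. carrier (Gs i))"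
    proof (rule image_subsetI)
      fix x assume "x \<in> f n"
      then show "restrict x {1..i} \<in> PiE {1..i} (\<lambda>i. carrier (Gs i))"
        using coord_closed[OF G_carrier[of x]] fG[of n] by auto
    qed
    show "finite (PiE {1..i} (\<lambda>i. carrier (Gs i)))"
      using finite_factor by (auto intro!: finite_PiE)
  qed
  have conv: "\<exists>m. f m \<subseteq> tail i" for i
  proof (induction i)
    case 0
    have "tail 0 = carrier P" by (auto simp: tail_def agree_def)
    then show ?case using fG G_carrier by blast
  next
    case (Suc i)
    then obtain m where m: "f m \<subseteq> tail i" by blast
    show ?case
    proof (rule ccontr)
      assume no: "\<nexists>m. f m \<subseteq> tail (Suc i)"
      \<comment> \<open>If no remainder entered \<open>tail (Suc i)\<close>, then from stage
        \<open>m\<close> on \<open>Suc i\<close> would be the least obstructed coordinate, and the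
        size of a finite projection would drop at every stage.\<close>
      have lt: "card (?img (Suc i) (f (Suc n))) < card (?img (Suc i) (f n))" if "m \<le> n" for n
      proof -
        have "f n \<subseteq> tail j" if "j < Suc i" for j
          using dec[OF \<open>m \<le> n\<close>] m tail_mono[of j i] that by auto
        moreover have "\<not> f n \<subseteq> tail (Suc i)"
          using no by simp
        moreover have "\<forall>i. \<not> f n \<subseteq> tail i \<and> (\<forall>j<i. f n \<subseteq> tail j) \<longrightarrow> ?img i (f (Suc n)) \<subset> ?img i (f n)"
          using f(2)[of n] by (elim conjE)
        ultimately have "?img (Suc i) (f (Suc n)) \<subset> ?img (Suc i) (f n)"
          by simp
        then show ?thesis
          using psubset_card_mono[OF fin] by blast
      qed
      have "card (?img (Suc i) (f (m + k))) + k \<le> card (?img (Suc i) (f m))" for k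
      proof (induction k)
        case (Suc k)
        then show ?case using lt[of "m + k", OF le_add1] unfolding add_Suc_right by linarith
      qed simp
      from this[of "Suc (card (?img (Suc i) (f m)))"] show False by simp
    qed
  qed
  have "\<forall>n. \<exists>pw. cyclic_split (f n) (fst pw) (snd pw) (f (Suc n))"
    unfolding split_paired_Ex fst_conv snd_conv using conjunct1[OF f(2)] by (intro allI)
  then obtain pw where pw: "\<And>n. cyclic_split (f n) (fst (pw n)) (snd (pw n)) (f (Suc n))"
    using choice[of "\<lambda>n pw. cyclic_split (f n) (fst pw) (snd pw) (f (Suc n))"] by blast
  show thesis
  \<comment> \<open>Dependent choice numbers the stages from 0, while the sequences of the statement
    start at 1.\<close>
  proof (rule that[of "\<lambda>m. f (m - 1)" "\<lambda>m. fst (pw (m - 1))" "\<lambda>m. snd (pw (m - 1))"])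
    show "\<exists>m\<ge>1. f (m - 1) \<subseteq> tail i" for i
    proof -
      obtain m where "f m \<subseteq> tail i" using conv by blast
      then show ?thesis by (intro exI[of _ "Suc m"]) simp
    qed
    show "cyclic_split (f (m - 1)) (fst (pw (m - 1))) (snd (pw (m - 1))) (f (Suc m - 1))"
      if "m \<ge> 1" for m
      using pw[of "m - 1"] that by simp
    show "f (n - 1) \<subseteq> f (m - 1)" if "1 \<le> m" "m \<le> n" for m n
      using dec[of "m - 1" "n - 1"] that by simp
  qed (use f(1) in auto)
qed

end

section \<open>Coefficient families in products of cyclic groups\<close>

context finite_comm_groups
begin

abbreviation cyc_prod :: "'l set \<Rightarrow> ('l \<Rightarrow> nat \<Rightarrow> 'a) \<Rightarrow> ('l \<Rightarrow> nat \<Rightarrow> 'a) set" where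
  "cyc_prod L g \<equiv> PiE L (\<lambda>n. generate P {g n})"

lemma generate_carrier: "g n \<in> carrier P \<Longrightarrow> generate P {g n} \<subseteq> carrier P"
  by (rule P.generate_incl) simp

lemma subgroup_cyclic: "u \<in> carrier P \<Longrightarrow> subgroup (generate P {u}) P"
  by (rule P.generate_is_subgroup) simp

lemma carrier_cyclic: "u \<in> carrier P \<Longrightarrow> carrier (subgroup_generated P {u}) = generate P {u}"
  by (simp add: carrier_subgroup_generated)

lemma agree_one_cyclic:
  assumes "u \<in> carrier P" "agree i u \<one>\<^bsub>P\<^esub>" "x \<in> generate P {u}"
  shows "agree i x \<one>\<^bsub>P\<^esub>"
proof -
  have "generate P {u} \<subseteq> tail i"
    using assms(1,2) by (intro P.generate_subgroup_incl subgroup_tail) (simp add: tail_def)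
  then show ?thesis
    using assms(3) by (auto simp: tail_def)
qed

text \<open>If a generator lies in the subgroup \<open>tail i\<close>, so does its cyclic group;
  hence every choice of coefficients converges at least as fast as the generators.\<close>

lemma null_family_cyc_prod:
  assumes "null_family L g" "x \<in> cyc_prod L g"
  shows "null_family L x"
proof -
  have g: "g n \<in> carrier P" and x: "x n \<in> generate P {g n}" if "n \<in> L" for n
    using that assms by (auto simp: null_family_def)
  have "finite {n \<in> L. \<not> agree i (x n) \<one>\<^bsub>P\<^esub>}" for i
  proof (rule finite_subset)
    show "{n \<in> L. \<not> agree i (x n) \<one>\<^bsub>P\<^esub>} \<subseteq> {n \<in> L. \<not> agree i (g n) \<one>\<^bsub>P\<^esub>}"
      using agree_one_cyclic[OF g _ x] by auto
    show "finite {n \<in> L. \<not> agree i (g n) \<one>\<^bsub>P\<^esub>}"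
      using assms(1) by (simp add: null_family_def)
  qed
  moreover have "x \<in> L \<rightarrow> carrier P"
    using generate_carrier[of g, OF g] x by (intro Pi_I) (rule subsetD)
  ultimately show ?thesis
    by (simp add: null_family_def)
qed

lemma inf_sum_null_closed: "null_family L x \<Longrightarrow> inf_sum L x \<in> carrier P"
  by (rule inf_sum_closed) (simp add: null_family_def)

lemma cyc_prod_mult:
  assumes "g \<in> L \<rightarrow> carrier P" "x \<in> cyc_prod L g" "y \<in> cyc_prod L g"
  shows "(\<lambda>n\<in>L. x n \<otimes>\<^bsub>P\<^esub> y n) \<in> cyc_prod L g" "(\<lambda>n\<in>L. x n \<otimes>\<^bsub>P\<^esub> inv\<^bsub>P\<^esub> y n) \<in> cyc_prod L g"
proof -
  have "subgroup (generate P {g n}) P" "x n \<in> generate P {g n}" "y n \<in> generate P {g n}"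
    if "n \<in> L" for n
    using that assms subgroup_cyclic by auto
  then show "(\<lambda>n\<in>L. x n \<otimes>\<^bsub>P\<^esub> y n) \<in> cyc_prod L g"
    "(\<lambda>n\<in>L. x n \<otimes>\<^bsub>P\<^esub> inv\<^bsub>P\<^esub> y n) \<in> cyc_prod L g"
    by (auto intro!: subgroup.m_closed subgroup.m_inv_closed)
qed

lemma inf_sum_cyc_mult:
  assumes "null_family L g" "x \<in> cyc_prod L g" "y \<in> cyc_prod L g"
  shows "inf_sum L (\<lambda>n\<in>L. x n \<otimes>\<^bsub>P\<^esub> y n) = inf_sum L x \<otimes>\<^bsub>P\<^esub> inf_sum L y"
proof -
  have xy: "null_family L x" "null_family L y"
    using assms null_family_cyc_prod by blast+
  have "inf_sum L (\<lambda>n\<in>L. x n \<otimes>\<^bsub>P\<^esub> y n) = inf_sum L (\<lambda>n. x n \<otimes>\<^bsub>P\<^esub> y n)"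
    using xy by (intro inf_sum_cong) (auto simp: null_family_def)
  then show ?thesis
    using inf_sum_mult[OF xy] by simp
qed

end

section \<open>Encoding a group by a null family of generators\<close>

context controllable_group
begin

text \<open>Bijectivity is all that has to be checked for an isomorphic encoder: for a null family
  summation is a continuous homomorphism, and finite support of the generators makes the domain
  compact, so that the inverse is continuous as well.\<close>

definition encodes :: "'l set \<Rightarrow> ('l \<Rightarrow> nat \<Rightarrow> 'a) \<Rightarrow> bool" where
  "encodes L g \<longleftrightarrow> g ` L \<subseteq> G \<inter> fin_supp Gs \<and> null_family L g \<and>
     bij_betw (inf_sum L) (cyc_prod L g) G"

lemma inf_sum_in_G:
  assumes "g ` L \<subseteq> G" "null_family L g" "x \<in> cyc_prod L g"
  shows "inf_sum L x \<in> G"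
proof (rule mem_G_if_agree)
  have nx: "null_family L x"
    using null_family_cyc_prod assms by blast
  then show "inf_sum L x \<in> carrier P"
    by (intro inf_sum_closed) (simp add: null_family_def)
  fix i
  let ?F = "{n \<in> L. \<not> agree i (x n) \<one>\<^bsub>P\<^esub>}"
  have "x n \<in> G" if "n \<in> L" for n
  proof -
    have "generate P {g n} \<subseteq> G"
      using that assms(1) by (intro P.generate_subgroup_incl subgroup_G) auto
    then show ?thesis using assms(3) that by blast
  qed
  then have "finprod P x ?F \<in> G"
    using nx by (intro finprod_in_subgroup[OF subgroup_G]) (auto simp: null_family_def)
  moreover have "agree i (finprod P x ?F) (inf_sum L x)"
    using nx by (intro agree_sym[OF agree_inf_sum]) (auto simp: null_family_def)
  ultimately show "\<exists>s\<in>G. agree i s (inf_sum L x)"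
    by blast
qed

text \<open>For injectivity, the first nontrivial coefficient of a vanishing sum would lie both in
  its cyclic group and in the complement \<open>R (Suc m)\<close> that contains all later terms. For
  surjectivity, components are peeled off one after another, and the remainders tend to the
  identity.\<close>

lemma splitting_sequence_encodes:
  assumes R1: "R 1 = G" and op: "\<And>m. m \<ge> 1 \<Longrightarrow> open_subgroup (R m)"
    and split: "\<And>m. m \<ge> 1 \<Longrightarrow> cyclic_split (R m) (p m) (w m) (R (Suc m))"
    and dec: "\<And>m n. 1 \<le> m \<Longrightarrow> m \<le> n \<Longrightarrow> R n \<subseteq> R m"
    and conv: "\<And>i. \<exists>m\<ge>1. R m \<subseteq> tail i"
  shows "encodes {1..} w"
proof -
  have Rs: "subgroup (R m) P" if "m \<ge> 1" for m
    using op[OF that] by (simp add: open_subgroup_def)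
  have wG: "w m \<in> G \<inter> fin_supp Gs" if "m \<ge> 1" for m
    using split[OF that] by (simp add: cyclic_split_def)
  have wc: "w m \<in> carrier P" if "m \<ge> 1" for m
    using wG[OF that] G_carrier by blast
  have wR: "w m \<in> R m" if "m \<ge> 1" for m
    using split[OF that] P.subgroup_adjoin(3)[OF Rs wc[OF that], of "Suc m"]
    by (simp add: cyclic_split_def)
  have cR: "generate P {w m} \<subseteq> R m" if "m \<ge> 1" for m
    using wR[OF that] by (intro P.generate_subgroup_incl Rs that) auto
  have null: "null_family {1..} w"
    unfolding null_family_def
  proof (intro conjI allI)
    show "w \<in> {1..} \<rightarrow> carrier P" using wc by auto
    fix i
    obtain M where M: "M \<ge> 1" "R M \<subseteq> tail i" using conv by blast
    have "m < M" if "m \<in> {1..}" "\<not> agree i (w m) \<one>\<^bsub>P\<^esub>" for m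
    proof (rule ccontr)
      assume "\<not> m < M"
      then have "w m \<in> tail i"
        using M dec[of M m] wR[of m] by auto
      then show False using that(2) by (simp add: tail_def)
    qed
    then show "finite {m \<in> {1..}. \<not> agree i (w m) \<one>\<^bsub>P\<^esub>}"
      by (intro finite_subset[OF _ finite_lessThan[of M]]) auto
  qed
  have wGs: "w ` {1..} \<subseteq> G" using wG by auto
  have triv: "d m = \<one>\<^bsub>P\<^esub>"
    if d: "d \<in> cyc_prod {1..} w" "inf_sum {1..} d = \<one>\<^bsub>P\<^esub>" and m: "m \<ge> 1" for d m
    using m
  proof (induction m rule: less_induct)
    case (less m)
    have m: "m \<ge> 1" by fact
    \<comment> \<open>Openness of \<open>R (Suc m)\<close> lets a finite partial product replace the
      vanishing sum: it is trivial up to \<open>k\<close>, hence in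
      \<open>R (Suc m)\<close>.\<close>
    obtain k where k: "G \<inter> tail k \<subseteq> R (Suc m)"
      using op[of "Suc m"] by (auto simp: open_subgroup_def)
    have nd: "null_family {1..} d"
      using null_family_cyc_prod[OF null d(1)] .
    \<comment> \<open>The index \<open>m\<close> is taken out and inserted again, so that the factor
      \<open>d m\<close> occurs exactly once whether or not it is trivial up to
      \<open>k\<close>.\<close>
    let ?F = "{n \<in> {1..}. \<not> agree k (d n) \<one>\<^bsub>P\<^esub>} - {m}"
    have finF: "finite ?F" using nd by (simp add: null_family_def)
    have dc: "d n \<in> carrier P" if "n \<ge> 1" for n
      using nd that by (auto simp: null_family_def)
    have dcyc: "d n \<in> generate P {w n}" if "n \<ge> 1" for n
      using PiE_mem[OF d(1), of n] that by simp
    have dG: "d n \<in> G" if "n \<ge> 1" for n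
      using dcyc[OF that] cR[OF that] op[OF that] unfolding open_subgroup_def by blast
    have "agree k (inf_sum {1..} d) (finprod P d (insert m ?F))"
      using nd finF m by (intro agree_inf_sum) (auto simp: null_family_def)
    then have "finprod P d (insert m ?F) \<in> tail k"
      using d(2) dc m agree_sym by (auto simp: tail_def intro!: P.finprod_closed)
    moreover have "finprod P d (insert m ?F) \<in> G"
      using finF m dG by (intro finprod_in_subgroup[OF subgroup_G]) auto
    ultimately have "finprod P d (insert m ?F) \<in> R (Suc m)"
      using k by blast
    moreover have "finprod P d (insert m ?F) = d m \<otimes>\<^bsub>P\<^esub> finprod P d ?F"
      using finF dc m by (intro P.finprod_insert) auto
    moreover have rest: "finprod P d ?F \<in> R (Suc m)"
    proof (rule finprod_in_subgroup[OF Rs finF])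
      show "d \<in> ?F \<rightarrow> R (Suc m)"
      proof
        fix n assume n: "n \<in> ?F"
        have "n > m"
        proof (rule ccontr)
          assume "\<not> n > m"
          then have "d n = \<one>\<^bsub>P\<^esub>" using less.IH n by simp
          then show False using n by (simp add: agree_def)
        qed
        then show "d n \<in> R (Suc m)"
          using dcyc[of n] cR[of n] dec[of "Suc m" n] n by auto
      qed
    qed simp
    ultimately have "(d m \<otimes>\<^bsub>P\<^esub> finprod P d ?F) \<otimes>\<^bsub>P\<^esub> inv\<^bsub>P\<^esub> finprod P d ?F \<in> R (Suc m)"
      using subgroup.m_closed[OF Rs] subgroup.m_inv_closed[OF Rs] by simp
    moreover have "finprod P d ?F \<in> carrier P"
      using dc by (intro P.finprod_closed) auto
    ultimately have "d m \<in> R (Suc m)"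
      using dc[OF m] by (simp add: P.m_assoc)
    then show ?case
      using dcyc[OF m] split[OF m] unfolding cyclic_split_def by blast
  qed
  have inj: "inj_on (inf_sum {1..}) (cyc_prod {1..} w)"
  proof (rule inj_onI)
    fix x y assume x: "x \<in> cyc_prod {1..} w" and y: "y \<in> cyc_prod {1..} w"
      and eq: "inf_sum {1..} x = inf_sum {1..} y"
    have xc: "x n \<in> carrier P" and yc: "y n \<in> carrier P" if "n \<in> {1..}" for n
      using null_family_cyc_prod[OF null x] null_family_cyc_prod[OF null y] that
      by (auto simp: null_family_def)
    let ?d = "\<lambda>n\<in>{1..}. x n \<otimes>\<^bsub>P\<^esub> inv\<^bsub>P\<^esub> y n"
    have d: "?d \<in> cyc_prod {1..} w"
      using cyc_prod_mult(2)[OF _ x y] wc by auto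
    have "inf_sum {1..} (\<lambda>n\<in>{1..}. ?d n \<otimes>\<^bsub>P\<^esub> y n) = inf_sum {1..} x"
      using xc yc by (intro inf_sum_cong) (auto simp: P.m_assoc)
    then have "inf_sum {1..} ?d \<otimes>\<^bsub>P\<^esub> inf_sum {1..} y = \<one>\<^bsub>P\<^esub> \<otimes>\<^bsub>P\<^esub> inf_sum {1..} y"
      using inf_sum_cyc_mult[OF null d y] eq inf_sum_closed[of y "{1..}"] yc by simp
    moreover have "inf_sum {1..} ?d \<in> carrier P" "inf_sum {1..} y \<in> carrier P"
      using inf_sum_null_closed null_family_cyc_prod[OF null d] null_family_cyc_prod[OF null y] by auto
    ultimately have "inf_sum {1..} ?d = \<one>\<^bsub>P\<^esub>"
      by simp
    then have d1: "?d n = \<one>\<^bsub>P\<^esub>" if "n \<ge> 1" for n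
      using triv[OF d _ that] by blast
    show "x = y"
    proof (rule PiE_ext[OF x y])
      fix n :: nat assume n: "n \<in> {1..}"
      then have "(x n \<otimes>\<^bsub>P\<^esub> inv\<^bsub>P\<^esub> y n) \<otimes>\<^bsub>P\<^esub> y n = y n"
        using d1[of n] yc[OF n] by simp
      then show "x n = y n"
        using xc[OF n] yc[OF n] by (simp add: P.m_assoc)
    qed
  qed
  have surj: "\<exists>x\<in>cyc_prod {1..} w. inf_sum {1..} x = c" if c: "c \<in> G" for c
  proof -
    \<comment> \<open>\<open>f n\<close> is the remainder of \<open>c\<close> after its components
      along \<open>w 1\<close> to \<open>w n\<close> have been split off.\<close>
    have "\<exists>f. \<forall>n. (f n \<in> R (Suc n) \<and> (n = 0 \<longrightarrow> f n = c)) \<and>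
        (\<exists>t\<in>generate P {w (Suc n)}. f n = f (Suc n) \<otimes>\<^bsub>P\<^esub> t)"
    proof (rule dependent_nat_choice[of "\<lambda>n s. s \<in> R (Suc n) \<and> (n = 0 \<longrightarrow> s = c)"
          "\<lambda>n s s'. \<exists>t\<in>generate P {w (Suc n)}. s = s' \<otimes>\<^bsub>P\<^esub> t"])
      show "\<exists>s. s \<in> R (Suc 0) \<and> (0 = (0::nat) \<longrightarrow> s = c)"
        using c R1 by (auto simp: One_nat_def)
      fix s n assume "s \<in> R (Suc n) \<and> (n = 0 \<longrightarrow> s = c)"
      then have "s \<in> R (Suc (Suc n)) <#>\<^bsub>P\<^esub> generate P {w (Suc n)}"
        using split[of "Suc n"] by (simp add: cyclic_split_def)
      then show "\<exists>s'. (s' \<in> R (Suc (Suc n)) \<and> (Suc n = 0 \<longrightarrow> s' = c)) \<and>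
          (\<exists>t\<in>generate P {w (Suc n)}. s = s' \<otimes>\<^bsub>P\<^esub> t)"
        unfolding set_mult_def by auto
    qed
    then obtain f where f0: "\<forall>n. (f n \<in> R (Suc n) \<and> (n = 0 \<longrightarrow> f n = c)) \<and>
        (\<exists>t\<in>generate P {w (Suc n)}. f n = f (Suc n) \<otimes>\<^bsub>P\<^esub> t)"
      by (rule exE)
    have "\<forall>n. \<exists>t. t \<in> generate P {w (Suc n)} \<and> f n = f (Suc n) \<otimes>\<^bsub>P\<^esub> t"
      using f0 by blast
    then obtain t where t: "\<And>n. t n \<in> generate P {w (Suc n)} \<and> f n = f (Suc n) \<otimes>\<^bsub>P\<^esub> t n"
      using choice[of "\<lambda>n t. t \<in> generate P {w (Suc n)} \<and> f n = f (Suc n) \<otimes>\<^bsub>P\<^esub> t"] by blast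
    define x where "x = (\<lambda>m\<in>{1..}. t (m - 1))"
    have x: "x \<in> cyc_prod {1..} w"
    proof
      fix m :: nat assume m: "m \<in> {1..}"
      then show "x m \<in> generate P {w m}"
        using t[of "m - 1"] by (simp add: x_def)
    qed (simp add: x_def)
    have nx: "null_family {1..} x"
      using null_family_cyc_prod[OF null x] .
    have xc: "x m \<in> carrier P" if "m \<ge> 1" for m
      using nx that by (auto simp: null_family_def)
    have fc: "f n \<in> carrier P" for n
      using f0 subgroup.mem_carrier[OF Rs[of "Suc n"]] by simp
    have partial: "c = f n \<otimes>\<^bsub>P\<^esub> finprod P x {1..n}" for n
    proof (induction n)
      case 0
      then show ?case using f0 fc[of 0] by simp
    next
      case (Suc n)
      have "{1..Suc n} = insert (Suc n) {1..n}" by auto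
      then have "finprod P x {1..Suc n} = x (Suc n) \<otimes>\<^bsub>P\<^esub> finprod P x {1..n}"
        using xc by (simp add: P.finprod_insert)
      moreover have "f n = f (Suc n) \<otimes>\<^bsub>P\<^esub> x (Suc n)"
        using t[of n] by (simp add: x_def)
      moreover have "finprod P x {1..n} \<in> carrier P"
        using xc by (intro P.finprod_closed) auto
      ultimately show ?case
        using Suc.IH fc xc[of "Suc n"] by (simp add: P.m_assoc)
    qed
    have "agree i (inf_sum {1..} x) c" for i
    proof -
      \<comment> \<open>From \<open>M\<close> on, the coefficients as well as the remainders lie in
        \<open>tail i\<close>, so neither affects the first \<open>i\<close> coordinates.\<close>
      obtain M where M: "M \<ge> 1" "R M \<subseteq> tail i" using conv by blast
      have RM: "R n \<subseteq> tail i" if "n \<ge> M" for n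
        using dec[OF M(1) that] M(2) by blast
      have "agree i (inf_sum {1..} x) (finprod P x {1..M})"
      proof (rule agree_inf_sum)
        fix n assume "n \<in> {1..} - {1..M}"
        then have "x n \<in> generate P {w n}" "generate P {w n} \<subseteq> R n" "R n \<subseteq> tail i"
          using PiE_mem[OF x, of n] cR[of n] RM[of n] by auto
        then have "x n \<in> tail i"
          by blast
        then show "agree i (x n) \<one>\<^bsub>P\<^esub>" by (simp add: tail_def)
      qed (use xc in auto)
      moreover have "agree i (finprod P x {1..M}) (f M \<otimes>\<^bsub>P\<^esub> finprod P x {1..M})"
      proof -
        have "f M \<in> tail i"
          using f0 RM[of "Suc M"] by auto
        then have "agree i (\<one>\<^bsub>P\<^esub> \<otimes>\<^bsub>P\<^esub> finprod P x {1..M}) (f M \<otimes>\<^bsub>P\<^esub> finprod P x {1..M})"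
          by (intro agree_mult) (auto simp: tail_def agree_def)
        moreover have "finprod P x {1..M} \<in> carrier P"
          using xc by (intro P.finprod_closed) auto
        ultimately show ?thesis by simp
      qed
      ultimately show ?thesis
        using partial[of M] by (simp add: agree_def)
    qed
    then have "inf_sum {1..} x = c"
      using G_carrier[OF c] inf_sum_closed[of x "{1..}"] xc by (intro agreeD_eq) auto
    then show ?thesis using x by blast
  qed
  have "inf_sum {1..} ` cyc_prod {1..} w = G"
    using surj inf_sum_in_G[OF wGs null] by (auto 4 3)
  then show ?thesis
    unfolding encodes_def bij_betw_def using inj null wG by auto
qed

end

section \<open>Encoders\<close>

context finite_comm_groups
begin

lemma ext_sum_iff:
  "x \<in> ext_sum P L B \<longleftrightarrow>
     x \<in> PiE L (\<lambda>n. carrier (subgroup_generated P (B n))) \<and> finite {n \<in> L. x n \<noteq> \<one>\<^bsub>P\<^esub>}"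
  unfolding ext_sum_def by (subst carrier_sum_group) auto

lemma cyc_prod_carrier:
  assumes "g \<in> L \<rightarrow> carrier P"
  shows "PiE L (\<lambda>n. carrier (subgroup_generated P {g n})) = cyc_prod L g"
  using assms by (intro PiE_cong carrier_cyclic) auto

lemma ext_sum_cyclic:
  assumes "g \<in> L \<rightarrow> carrier P"
  shows "ext_sum P L (\<lambda>n. {g n}) = {x \<in> cyc_prod L g. finite {n \<in> L. x n \<noteq> \<one>\<^bsub>P\<^esub>}}"
  using cyc_prod_carrier[OF assms] by (auto simp: ext_sum_iff)

lemma cyc_prod_funcset:
  assumes "g \<in> L \<rightarrow> carrier P" "x \<in> cyc_prod L g"
  shows "x \<in> L \<rightarrow> carrier P"
proof
  fix n assume n: "n \<in> L"
  then have "generate P {g n} \<subseteq> carrier P"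
    using assms(1) by (intro generate_carrier) auto
  then show "x n \<in> carrier P"
    using PiE_mem[OF assms(2) n] by blast
qed

lemma cyc_prod_cut:
  assumes "x \<in> cyc_prod L g"
  shows "(\<lambda>n\<in>L. if n \<in> F then x n else \<one>\<^bsub>P\<^esub>) \<in> cyc_prod L g"
proof
  fix n assume "n \<in> L"
  then show "(\<lambda>n\<in>L. if n \<in> F then x n else \<one>\<^bsub>P\<^esub>) n \<in> generate P {g n}"
    using PiE_mem[OF assms, of n] by (simp add: generate.one)
qed simp

lemma gfinprod_in_subgroup:
  assumes "subgroup H P" "x \<in> L \<rightarrow> H"
  shows "gfinprod P x L \<in> H"
proof (cases "finite {n \<in> L. x n \<noteq> \<one>\<^bsub>P\<^esub>}")
  case True
  have "x \<in> {n \<in> L. x n \<noteq> \<one>\<^bsub>P\<^esub>} \<rightarrow> H"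
    using assms(2) by auto
  then show ?thesis
    using True finprod_in_subgroup[OF assms(1) True] by (simp add: gfinprod_def)
next
  case False
  then show ?thesis
    using subgroup.one_closed[OF assms(1)] by (simp add: gfinprod_def)
qed

text \<open>Coordinate \<open>i\<close> of the sum depends only on the coefficients at the finitely
  many \<open>n\<close> whose generator is nontrivial up to \<open>i\<close>. Fixing these
  coefficients gives a basic open set on which the coordinate is constant.\<close>

lemma continuous_map_inf_sum:
  assumes g: "null_family L g"
  shows "continuous_map
    (product_topology (\<lambda>n. discrete_topology (carrier (subgroup_generated P {g n}))) L)
    (prod_top Gs) (inf_sum L)"
proof -
  let ?T = "product_topology (\<lambda>n. discrete_topology (carrier (subgroup_generated P {g n}))) L"
  have gc: "g \<in> L \<rightarrow> carrier P" using g by (simp add: null_family_def)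
  have top: "topspace ?T = cyc_prod L g"
    using cyc_prod_carrier[OF gc] by simp
  have "continuous_map ?T (discrete_topology (carrier (Gs i))) (\<lambda>x. inf_sum L x i)" if i: "i \<ge> 1" for i
    unfolding continuous_map_def top
  proof (intro conjI allI impI)
    show "(\<lambda>x. inf_sum L x i) \<in> cyc_prod L g \<rightarrow> topspace (discrete_topology (carrier (Gs i)))"
      using coord_closed[OF inf_sum_closed[OF cyc_prod_funcset[OF gc]] i] by auto
    fix U :: "'a set"
    show "openin ?T {x \<in> cyc_prod L g. inf_sum L x i \<in> U}"
      unfolding openin_product_topology_alt
    proof
      fix x assume "x \<in> {x \<in> cyc_prod L g. inf_sum L x i \<in> U}"
      then have x: "x \<in> cyc_prod L g" "inf_sum L x i \<in> U" by auto
      let ?F = "{n \<in> L. \<not> agree i (g n) \<one>\<^bsub>P\<^esub>}"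
      let ?W = "\<lambda>n. if n \<in> ?F then {x n} else carrier (subgroup_generated P {g n})"
      have finF: "finite ?F" using g by (simp add: null_family_def)
      have xL: "x n \<in> carrier (subgroup_generated P {g n})" if "n \<in> L" for n
        using x(1) that unfolding cyc_prod_carrier[OF gc, symmetric] by auto
      have "PiE L ?W \<subseteq> {x \<in> cyc_prod L g. inf_sum L x i \<in> U}"
      proof
        fix z assume z: "z \<in> PiE L ?W"
        have "z n \<in> carrier (subgroup_generated P {g n})" if "n \<in> L" for n
          using PiE_mem[OF z that] xL[OF that] by (auto split: if_splits)
        then have zc: "z \<in> cyc_prod L g"
          using z unfolding cyc_prod_carrier[OF gc, symmetric] by (auto simp: PiE_iff)
        have part: "agree i (inf_sum L v) (finprod P v ?F)" if v: "v \<in> cyc_prod L g" for v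
        proof (rule agree_inf_sum[OF cyc_prod_funcset[OF gc v] finF])
          fix n assume "n \<in> L - ?F"
          then show "agree i (v n) \<one>\<^bsub>P\<^esub>"
            using agree_one_cyclic[of "g n" i "v n"] gc PiE_mem[OF v, of n] by auto
        qed simp
        have "agree i (inf_sum L z) (finprod P z ?F)" "agree i (inf_sum L x) (finprod P x ?F)"
          using part[OF zc] part[OF x(1)] .
        moreover have "finprod P z ?F = finprod P x ?F"
        proof (rule P.finprod_cong')
          show "x \<in> ?F \<rightarrow> carrier P"
            using cyc_prod_funcset[OF gc x(1)] by auto
          show "z n = x n" if "n \<in> ?F" for n
            using PiE_mem[OF z, of n] that by auto
        qed simp
        ultimately have "inf_sum L z i = inf_sum L x i"
          using i by (simp add: agree_def)
        then show "z \<in> {x \<in> cyc_prod L g. inf_sum L x i \<in> U}"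
          using zc x(2) by simp
      qed
      moreover have "x \<in> PiE L ?W"
        using x(1) xL by (auto simp: PiE_iff)
      moreover have "finite {n \<in> L. ?W n \<noteq> topspace (discrete_topology (carrier (subgroup_generated P {g n})))}"
        by (rule finite_subset[OF _ finF]) auto
      moreover have "\<forall>n\<in>L. openin (discrete_topology (carrier (subgroup_generated P {g n}))) (?W n)"
        using xL by auto
      ultimately show "\<exists>W. finite {n \<in> L. W n \<noteq> topspace (discrete_topology (carrier (subgroup_generated P {g n})))} \<and>
          (\<forall>n\<in>L. openin (discrete_topology (carrier (subgroup_generated P {g n}))) (W n)) \<and>
          x \<in> PiE L W \<and> PiE L W \<subseteq> {x \<in> cyc_prod L g. inf_sum L x i \<in> U}"
        by (intro exI[of _ ?W] conjI)
    qed
  qed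
  then show ?thesis
    unfolding prod_top_def continuous_map_componentwise by (auto simp: inf_sum_def)
qed

end

context controllable_group
begin

lemma encodes_funcset: "encodes L g \<Longrightarrow> g \<in> L \<rightarrow> carrier P"
  by (simp add: encodes_def null_family_def)

text \<open>Directness is the restriction of injectivity to finite sums. For density, write an
  element of \<open>G\<close> as an infinite sum and keep only the coefficients that are nontrivial
  up to \<open>i\<close>: this finite sum agrees with the element up to \<open>i\<close>.\<close>

lemma encodes_generating_set:
  assumes e: "encodes L g" and L: "countable L"
  shows "generating_set Gs G L g"
proof -
  have gG: "g ` L \<subseteq> G \<inter> fin_supp Gs" and null: "null_family L g"
    and bij: "bij_betw (inf_sum L) (cyc_prod L g) G"
    using e by (auto simp: encodes_def)
  have gc: "g \<in> L \<rightarrow> carrier P" using e by (rule encodes_funcset)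
  note ext = ext_sum_cyclic[OF gc]
  have sum_eq: "gfinprod P x L = inf_sum L x" if "x \<in> ext_sum P L (\<lambda>n. {g n})" for x
    using inf_sum_eq_gfinprod[OF cyc_prod_funcset[OF gc]] that ext by auto
  have "inj_on (inf_sum L) (ext_sum P L (\<lambda>n. {g n}))"
    using bij unfolding bij_betw_def ext by (auto intro: inj_on_subset)
  moreover have "inj_on (\<lambda>x. gfinprod P x L) (ext_sum P L (\<lambda>n. {g n})) \<longleftrightarrow>
      inj_on (inf_sum L) (ext_sum P L (\<lambda>n. {g n}))"
    by (rule inj_on_cong) (rule sum_eq)
  ultimately have "is_direct P L (\<lambda>n. {g n})"
    by (simp add: is_direct_def)
  moreover have "subtopology (prod_top Gs) G closure_of int_sum P L (\<lambda>n. {g n}) = G"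
  proof -
    have "c \<in> prod_top Gs closure_of (G \<inter> int_sum P L (\<lambda>n. {g n}))" if c: "c \<in> G" for c
      unfolding in_closure_prod_top
    proof (intro conjI allI)
      show "c \<in> carrier P" using c G_carrier by blast
      fix i
      obtain x where x: "x \<in> cyc_prod L g" "inf_sum L x = c"
        using bij c unfolding bij_betw_def by blast
      let ?F = "{n \<in> L. \<not> agree i (x n) \<one>\<^bsub>P\<^esub>}"
      let ?x = "\<lambda>n\<in>L. if n \<in> ?F then x n else \<one>\<^bsub>P\<^esub>"
      have nx: "null_family L x" using null_family_cyc_prod[OF null x(1)] .
      then have fin: "finite ?F" by (simp add: null_family_def)
      have xc: "x \<in> L \<rightarrow> carrier P" using cyc_prod_funcset[OF gc x(1)] .
      have y: "?x \<in> cyc_prod L g"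
        using cyc_prod_cut[OF x(1)] .
      have yc: "?x \<in> L \<rightarrow> carrier P" using cyc_prod_funcset[OF gc y] .
      have "finite {n \<in> L. ?x n \<noteq> \<one>\<^bsub>P\<^esub>}"
        by (rule finite_subset[OF _ fin]) auto
      then have yext: "?x \<in> ext_sum P L (\<lambda>n. {g n})"
        using y ext by blast
      have "agree i (inf_sum L x) (finprod P x ?F)"
        by (rule agree_inf_sum[OF xc fin]) auto
      moreover have "agree i (inf_sum L ?x) (finprod P ?x ?F)"
        by (rule agree_inf_sum[OF yc fin]) (auto simp: agree_def)
      moreover have "finprod P ?x ?F = finprod P x ?F"
        using xc by (intro P.finprod_cong') auto
      ultimately have "agree i (inf_sum L ?x) c"
        using x(2) by (simp add: agree_def)
      moreover have "inf_sum L ?x \<in> int_sum P L (\<lambda>n. {g n})"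
        unfolding int_sum_def using yext sum_eq[OF yext] by (auto intro!: image_eqI[of _ _ ?x])
      moreover have "inf_sum L ?x \<in> G"
        using bij y unfolding bij_betw_def by blast
      ultimately show "\<exists>s\<in>G \<inter> int_sum P L (\<lambda>n. {g n}) \<inter> carrier P. agree i s c"
        using G_carrier by blast
    qed
    then show ?thesis
      unfolding closure_of_subtopology by blast
  qed
  ultimately show ?thesis
    unfolding generating_set_def using L gG by blast
qed

text \<open>A continuous bijection from a compact space onto a Hausdorff space is a homeomorphism.
  The domain is compact because every generator has finite support, hence finite order.\<close>

lemma encodes_isomorphic_encoder:
  assumes e: "encodes L g" and L: "countable L"
  shows "isomorphic_encoder Gs G L g (inf_sum L)"
  unfolding isomorphic_encoder_def
proof (intro conjI ballI)
  have null: "null_family L g" and bij: "bij_betw (inf_sum L) (cyc_prod L g) G"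
    using e by (auto simp: encodes_def)
  have gc: "g \<in> L \<rightarrow> carrier P" using e by (rule encodes_funcset)
  let ?T = "product_topology (\<lambda>n. discrete_topology (carrier (subgroup_generated P {g n}))) L"
  have carr: "carrier (subgroup_generated P G) = G"
    using subgroup.carrier_subgroup_generated_subgroup[OF subgroup_G] .
  show "generating_set Gs G L g"
    by (rule encodes_generating_set[OF e L])
  show "inf_sum L x = gfinprod P x L" if "x \<in> ext_sum P L (\<lambda>n. {g n})" for x
    using that inf_sum_eq_gfinprod[OF cyc_prod_funcset[OF gc]] ext_sum_cyclic[OF gc] by auto
  have "inf_sum L \<in> hom (product_group L (\<lambda>n. subgroup_generated P {g n})) (subgroup_generated P G)"
    using bij_betwE[OF bij] inf_sum_cyc_mult[OF null] carr
    by (intro homI) (auto simp: carrier_product_group mult_product_group cyc_prod_carrier[OF gc])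
  then show "inf_sum L \<in> iso (product_group L (\<lambda>n. subgroup_generated P {g n})) (subgroup_generated P G)"
    using bij carr by (simp add: iso_def carrier_product_group cyc_prod_carrier[OF gc])
  have Gsub: "G \<subseteq> topspace (prod_top Gs)"
    using G_carrier topspace_prod_top by blast
  show "homeomorphic_map ?T (subtopology (prod_top Gs) G) (inf_sum L)"
  proof (rule continuous_imp_homeomorphic_map)
    show "continuous_map ?T (subtopology (prod_top Gs) G) (inf_sum L)"
      using continuous_map_inf_sum[OF null] bij_betwE[OF bij]
      by (auto simp: continuous_map_in_subtopology cyc_prod_carrier[OF gc])
    have "finite (carrier (subgroup_generated P {g n}))" if n: "n \<in> L" for n
    proof -
      have gn: "g n \<in> carrier P" "g n \<in> fin_supp Gs"
        using n gc e by (auto simp: encodes_def)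
      obtain N where N: "N > 0" "g n [^]\<^bsub>P\<^esub> (N::nat) = \<one>\<^bsub>P\<^esub>"
        using fin_supp_torsion[OF gn(2)] by blast
      have "generate P {g n} \<subseteq> (\<lambda>k. g n [^]\<^bsub>P\<^esub> k) ` {0..<int N}"
      proof
        fix z assume "z \<in> generate P {g n}"
        then obtain k :: int where k: "z = g n [^]\<^bsub>P\<^esub> k"
          using P.generate_pow[OF gn(1)] by auto
        have "g n [^]\<^bsub>P\<^esub> k = (g n [^]\<^bsub>P\<^esub> int N) [^]\<^bsub>P\<^esub> (k div int N) \<otimes>\<^bsub>P\<^esub> g n [^]\<^bsub>P\<^esub> (k mod int N)"
          using gn(1) by (simp only: P.int_pow_pow P.int_pow_mult[symmetric] mult_div_mod_eq)
        then have "z = g n [^]\<^bsub>P\<^esub> (k mod int N)"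
          using k N(2) gn(1) by (simp add: int_pow_int)
        then show "z \<in> (\<lambda>k. g n [^]\<^bsub>P\<^esub> k) ` {0..<int N}"
          using N(1) by auto
      qed
      then show ?thesis
        unfolding carrier_cyclic[OF gn(1)] by (rule finite_subset) simp
    qed
    then show "compact_space ?T"
      by (auto simp: compact_space_product_topology compact_space_discrete_topology)
    have "Hausdorff_space (prod_top Gs)"
      unfolding prod_top_def Hausdorff_space_product_topology by simp
    then show "Hausdorff_space (subtopology (prod_top Gs) G)"
      by (rule Hausdorff_space_subtopology)
    show "inf_sum L ` topspace ?T = topspace (subtopology (prod_top Gs) G)"
      using bij Gsub by (auto simp: bij_betw_def cyc_prod_carrier[OF gc] topspace_subtopology)
    show "inj_on (inf_sum L) (topspace ?T)"
      using bij by (simp add: bij_betw_def cyc_prod_carrier[OF gc])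
  qed
qed

end

section \<open>Powers, kernels and changes of the index set\<close>

context finite_comm_groups
begin

lemma cyc_prod_pow:
  assumes "g \<in> L \<rightarrow> carrier P" "x \<in> cyc_prod L g"
  shows "(\<lambda>n\<in>L. x n [^]\<^bsub>P\<^esub> (k::nat)) \<in> cyc_prod L g"
proof
  fix n assume n: "n \<in> L"
  then have "subgroup (generate P {g n}) P"
    using assms(1) by (intro subgroup_cyclic) auto
  then show "(\<lambda>n\<in>L. x n [^]\<^bsub>P\<^esub> k) n \<in> generate P {g n}"
    using PiE_mem[OF assms(2) n] n by (simp add: P.subgroup_nat_pow_closed)
qed simp

lemma inf_sum_one: "inf_sum L (\<lambda>n\<in>L. \<one>\<^bsub>P\<^esub>) = \<one>\<^bsub>P\<^esub>"
proof -
  have "inf_sum L (\<lambda>n\<in>L. \<one>\<^bsub>P\<^esub>) = gfinprod P (\<lambda>n\<in>L. \<one>\<^bsub>P\<^esub>) L"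
    by (rule inf_sum_eq_gfinprod) auto
  also have "\<dots> \<in> {\<one>\<^bsub>P\<^esub>}"
    by (rule gfinprod_in_subgroup[OF P.triv_subgroup]) auto
  finally show ?thesis by simp
qed

lemma inf_sum_cyc_pow:
  assumes null: "null_family L g" and x: "x \<in> cyc_prod L g"
  shows "inf_sum L (\<lambda>n\<in>L. x n [^]\<^bsub>P\<^esub> (k::nat)) = inf_sum L x [^]\<^bsub>P\<^esub> k"
proof (induction k)
  case 0
  then show ?case unfolding nat_pow_0 by (rule inf_sum_one)
next
  case (Suc k)
  have gc: "g \<in> L \<rightarrow> carrier P" using null by (simp add: null_family_def)
  let ?y = "\<lambda>n\<in>L. x n [^]\<^bsub>P\<^esub> k"
  have y: "?y \<in> cyc_prod L g" using cyc_prod_pow[OF gc x] .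
  have "(\<lambda>n\<in>L. x n [^]\<^bsub>P\<^esub> Suc k) = (\<lambda>n\<in>L. ?y n \<otimes>\<^bsub>P\<^esub> x n)"
    by (rule restrict_ext) simp
  then have "inf_sum L (\<lambda>n\<in>L. x n [^]\<^bsub>P\<^esub> Suc k) = inf_sum L ?y \<otimes>\<^bsub>P\<^esub> inf_sum L x"
    using inf_sum_cyc_mult[OF null y x] by simp
  then show ?case unfolding Suc.IH nat_pow_Suc .
qed

end

context controllable_group
begin

lemma encodes_kernel:
  assumes e: "encodes L g" and x: "x \<in> cyc_prod L g" "inf_sum L x = \<one>\<^bsub>P\<^esub>" and n: "n \<in> L"
  shows "x n = \<one>\<^bsub>P\<^esub>"
proof -
  have one: "(\<lambda>n\<in>L. \<one>\<^bsub>P\<^esub>) \<in> cyc_prod L g"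
    using generate.one by fastforce
  have inj: "inj_on (inf_sum L) (cyc_prod L g)"
    using e by (simp add: encodes_def bij_betw_def)
  have "inf_sum L x = inf_sum L (\<lambda>n\<in>L. \<one>\<^bsub>P\<^esub>)"
    unfolding inf_sum_one by (rule x(2))
  then have "x = (\<lambda>n\<in>L. \<one>\<^bsub>P\<^esub>)"
    using inj_onD[OF inj _ x(1) one] by blast
  then show ?thesis using n by simp
qed

text \<open>Trivial generators contribute one-element factors, so they may be dropped or added
  freely while the others are renamed along \<open>\<psi>\<close>. This allows passing from a
  sequence to a family indexed by pairs of an index and a prime.\<close>

lemma encodes_reindex:
  fixes L1 :: "'k set" and L :: "'l set"
  assumes e: "encodes L1 g1" and L0: "L0 \<subseteq> L1" and inj: "inj_on \<psi> L0" and im: "\<psi> ` L0 \<subseteq> L"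
    and g: "\<And>n. n \<in> L0 \<Longrightarrow> g (\<psi> n) = g1 n"
    and triv1: "\<And>n. n \<in> L1 - L0 \<Longrightarrow> g1 n = \<one>\<^bsub>P\<^esub>" and triv: "\<And>n. n \<in> L - \<psi> ` L0 \<Longrightarrow> g n = \<one>\<^bsub>P\<^esub>"
  shows "encodes L g"
proof -
  have null1: "null_family L1 g1" and bij1: "bij_betw (inf_sum L1) (cyc_prod L1 g1) G"
    and g1G: "g1 ` L1 \<subseteq> G \<inter> fin_supp Gs"
    using e by (auto simp: encodes_def)
  have gen1: "generate P {\<one>\<^bsub>P\<^esub>} = {\<one>\<^bsub>P\<^esub>}"
    using P.generate_one by simp
  have gG: "g ` L \<subseteq> G \<inter> fin_supp Gs"
  proof (rule image_subsetI)
    fix n assume n: "n \<in> L"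
    show "g n \<in> G \<inter> fin_supp Gs"
    proof (cases "n \<in> \<psi> ` L0")
      case True
      then obtain m where m: "m \<in> L0" "n = \<psi> m" by blast
      then have "g n = g1 m" "m \<in> L1"
        using g L0 by auto
      then show ?thesis using g1G by auto
    next
      case False
      then show ?thesis
        using triv n subgroup.one_closed[OF subgroup_G] subgroup.one_closed[OF subgroup_fin_supp] by simp
    qed
  qed
  have gc: "g \<in> L \<rightarrow> carrier P"
    using gG G_carrier by auto
  have null: "null_family L g"
    unfolding null_family_def
  proof (intro conjI allI)
    fix i
    have "{n \<in> L. \<not> agree i (g n) \<one>\<^bsub>P\<^esub>} \<subseteq> \<psi> ` {n \<in> L1. \<not> agree i (g1 n) \<one>\<^bsub>P\<^esub>}"
    proof
      fix n assume n: "n \<in> {n \<in> L. \<not> agree i (g n) \<one>\<^bsub>P\<^esub>}"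
      have "n \<in> \<psi> ` L0"
      proof (rule ccontr)
        assume "n \<notin> \<psi> ` L0"
        then have "g n = \<one>\<^bsub>P\<^esub>" using triv n by blast
        then show False using n by (simp add: agree_def)
      qed
      then show "n \<in> \<psi> ` {n \<in> L1. \<not> agree i (g1 n) \<one>\<^bsub>P\<^esub>}"
        using n g L0 by auto
    qed
    then show "finite {n \<in> L. \<not> agree i (g n) \<one>\<^bsub>P\<^esub>}"
      using null1 by (auto simp: null_family_def intro: finite_surj)
  qed (rule gc)
  \<comment> \<open>\<open>T\<close> pulls coefficients back along \<open>\<psi>\<close> and
    \<open>T'\<close> transports them forward. At the trivial generators both put
    \<open>\<one>\<close>, the only possible coefficient there, so the two maps are mutually
    inverse.\<close>
  define T where "T x = (\<lambda>n\<in>L1. if n \<in> L0 then x (\<psi> n) else \<one>\<^bsub>P\<^esub>)" for x :: "'l \<Rightarrow> nat \<Rightarrow> 'a"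
  define T' where "T' z = (\<lambda>n\<in>L. if n \<in> \<psi> ` L0 then z (the_inv_into L0 \<psi> n) else \<one>\<^bsub>P\<^esub>)" for z :: "'k \<Rightarrow> nat \<Rightarrow> 'a"
  have Tx: "T x \<in> cyc_prod L1 g1" if x: "x \<in> cyc_prod L g" for x
  proof
    fix n assume n: "n \<in> L1"
    show "T x n \<in> generate P {g1 n}"
    proof (cases "n \<in> L0")
      case True
      then have "\<psi> n \<in> L" using im by blast
      then show ?thesis using PiE_mem[OF x, of "\<psi> n"] g[OF True] n True by (simp add: T_def)
    next
      case False
      then show ?thesis using n by (simp add: T_def generate.one)
    qed
  qed (simp add: T_def)
  have T'z: "T' z \<in> cyc_prod L g" if z: "z \<in> cyc_prod L1 g1" for z
  proof
    fix n assume n: "n \<in> L"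
    show "T' z n \<in> generate P {g n}"
    proof (cases "n \<in> \<psi> ` L0")
      case True
      then obtain m where m: "m \<in> L0" "n = \<psi> m" by blast
      then have "T' z n = z m"
        using n inj by (simp add: T'_def the_inv_into_f_f)
      then show ?thesis using PiE_mem[OF z, of m] m L0 g[OF m(1)] by auto
    next
      case False
      then show ?thesis using n by (simp add: T'_def generate.one)
    qed
  qed (simp add: T'_def)
  have "bij_betw T (cyc_prod L g) (cyc_prod L1 g1)"
  proof (rule bij_betw_byWitness[where f' = T'])
    show "\<forall>x\<in>cyc_prod L g. T' (T x) = x"
    proof
      fix x assume x: "x \<in> cyc_prod L g"
      show "T' (T x) = x"
      proof (rule PiE_ext[OF T'z[OF Tx[OF x]] x])
        fix n assume n: "n \<in> L"
        show "T' (T x) n = x n"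
        proof (cases "n \<in> \<psi> ` L0")
          case True
          then obtain m where m: "m \<in> L0" "n = \<psi> m" by blast
          then show ?thesis
            using n inj L0 by (auto simp: T'_def T_def the_inv_into_f_f)
        next
          case False
          then have "x n = \<one>\<^bsub>P\<^esub>"
            using PiE_mem[OF x n] triv[of n] n gen1 by simp
          then show ?thesis using n False by (simp add: T'_def)
        qed
      qed
    qed
    show "\<forall>z\<in>cyc_prod L1 g1. T (T' z) = z"
    proof
      fix z assume z: "z \<in> cyc_prod L1 g1"
      show "T (T' z) = z"
      proof (rule PiE_ext[OF Tx[OF T'z[OF z]] z])
        fix n assume n: "n \<in> L1"
        show "T (T' z) n = z n"
        proof (cases "n \<in> L0")
          case True
          then show ?thesis
            using n inj im by (auto simp: T'_def T_def the_inv_into_f_f)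
        next
          case False
          then have "z n = \<one>\<^bsub>P\<^esub>"
            using PiE_mem[OF z n] triv1[of n] n gen1 by simp
          then show ?thesis using n False by (simp add: T_def)
        qed
      qed
    qed
  qed (use Tx T'z in auto)
  then have "bij_betw (inf_sum L1 \<circ> T) (cyc_prod L g) G"
    using bij1 by (rule bij_betw_trans)
  moreover have "(inf_sum L1 \<circ> T) x = inf_sum L x" if x: "x \<in> cyc_prod L g" for x
  proof -
    have nx: "null_family L x" and nT: "null_family L1 (T x)"
      using null_family_cyc_prod[OF null x] null_family_cyc_prod[OF null1 Tx[OF x]] .
    have "agree i (inf_sum L1 (T x)) (inf_sum L x)" for i
    proof -
      let ?F = "{n \<in> L0. \<not> agree i (x (\<psi> n)) \<one>\<^bsub>P\<^esub>}"
      have TF: "T x n = x (\<psi> n)" if "n \<in> L0" for n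
        using that L0 by (auto simp: T_def)
      have "?F \<subseteq> {n \<in> L1. \<not> agree i (T x n) \<one>\<^bsub>P\<^esub>}"
        using TF L0 by auto
      then have finF: "finite ?F"
        by (rule finite_subset) (use nT in \<open>simp add: null_family_def\<close>)
      have xc: "x \<in> L \<rightarrow> carrier P" and Tc: "T x \<in> L1 \<rightarrow> carrier P"
        using nx nT by (auto simp: null_family_def)
      have "agree i (inf_sum L1 (T x)) (finprod P (T x) ?F)"
      proof (rule agree_inf_sum[OF Tc finF])
        show "agree i (T x n) \<one>\<^bsub>P\<^esub>" if "n \<in> L1 - ?F" for n
          using that by (auto simp: T_def agree_def)
      qed (use L0 in auto)
      moreover have "agree i (inf_sum L x) (finprod P x (\<psi> ` ?F))"
      proof (rule agree_inf_sum[OF xc])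
        show "agree i (x n) \<one>\<^bsub>P\<^esub>" if n: "n \<in> L - \<psi> ` ?F" for n
        proof (cases "n \<in> \<psi> ` L0")
          case True
          then show ?thesis using n by auto
        next
          case False
          then have "x n = \<one>\<^bsub>P\<^esub>"
            using PiE_mem[OF x, of n] triv[of n] n gen1 by simp
          then show ?thesis by (simp add: agree_def)
        qed
      qed (use finF im in auto)
      moreover have "finprod P x (\<psi> ` ?F) = finprod P (T x) ?F"
      proof -
        have "finprod P x (\<psi> ` ?F) = finprod P (\<lambda>n. x (\<psi> n)) ?F"
          using xc im by (intro P.finprod_reindex inj_on_subset[OF inj]) auto
        also have "\<dots> = finprod P (T x) ?F"
          using Tc L0 TF by (intro P.finprod_cong') auto
        finally show ?thesis .
      qed
      ultimately show ?thesis by (simp add: agree_def)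
    qed
    then show ?thesis
      using agreeD_eq[OF inf_sum_null_closed[OF nT] inf_sum_null_closed[OF nx]] by simp
  qed
  ultimately have "bij_betw (inf_sum L) (cyc_prod L g) G"
    by (rule bij_betw_cong[THEN iffD1, rotated])
  then show ?thesis
    unfolding encodes_def using gG null by blast
qed

section \<open>Prime power orders and finitely supported sums\<close>

lemma cyclic_pow_one:
  assumes "w \<in> carrier P" "x \<in> generate P {w}" "w [^]\<^bsub>P\<^esub> (N::nat) = \<one>\<^bsub>P\<^esub>"
  shows "x [^]\<^bsub>P\<^esub> N = \<one>\<^bsub>P\<^esub>"
proof -
  obtain k :: int where k: "x = w [^]\<^bsub>P\<^esub> k"
    using assms(2) P.generate_pow[OF assms(1)] by auto
  have "x [^]\<^bsub>P\<^esub> N = (w [^]\<^bsub>P\<^esub> int N) [^]\<^bsub>P\<^esub> k"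
    unfolding k using assms(1) by (simp add: P.int_pow_pow mult.commute flip: int_pow_int)
  then show ?thesis
    using assms(3) by (simp add: int_pow_int)
qed

lemma ord_prime_power:
  assumes "w \<in> carrier P" "Factorial_Ring.prime (p::nat)" "w [^]\<^bsub>P\<^esub> (p ^ e) = \<one>\<^bsub>P\<^esub>"
  shows "\<exists>k. group.ord P w = p ^ k"
  using assms(3) P.pow_eq_id[OF assms(1), of "p ^ e"]
    divides_primepow_nat[OF assms(2), of "group.ord P w" e] by auto

text \<open>The cyclic group generated by \<open>w\<close> is the required nontrivial
  \<open>p\<close>-subgroup.\<close>

lemma primes_ofI:
  assumes "w \<in> G" "w \<noteq> \<one>\<^bsub>P\<^esub>" "Factorial_Ring.prime (p::nat)" "w [^]\<^bsub>P\<^esub> (p ^ e) = \<one>\<^bsub>P\<^esub>"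
  shows "p \<in> primes_of P G"
proof -
  have wc: "w \<in> carrier P" using assms(1) G_carrier by blast
  have sub: "subgroup (generate P {w}) P" using subgroup_cyclic[OF wc] .
  have "generate P {w} \<subseteq> G"
    using assms(1) by (intro P.generate_subgroup_incl subgroup_G) simp
  moreover have "p_part P p (generate P {w}) = generate P {w}"
    unfolding p_part_def
    using ord_prime_power[OF subgroup.mem_carrier[OF sub] assms(3) cyclic_pow_one[OF wc _ assms(4)]]
    by auto
  moreover have "generate P {w} \<noteq> {\<one>\<^bsub>P\<^esub>}"
    using assms(2) generate.incl[of w "{w}" P] by auto
  ultimately show ?thesis
    unfolding primes_of_def using sub assms(3) by blast
qed

text \<open>Weak observability yields some finite representation of an element of the socle closure.
  Injectivity of infinite summation then shows that this is the given representation. The socles are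
  formed from \<open>w m\<close> if \<open>p m = q\<close> and from \<open>\<one>\<close> otherwise,
  matching the family indexed by pairs.\<close>

lemma encodes_finite_support:
  fixes p :: "nat \<Rightarrow> nat" and w :: "nat \<Rightarrow> nat \<Rightarrow> 'a"
  assumes e: "encodes {1..} w"
    and prime: "\<And>m. m \<ge> 1 \<Longrightarrow> Factorial_Ring.prime (p m) \<and> (\<exists>e. w m [^]\<^bsub>P\<^esub> (p m ^ e) = \<one>\<^bsub>P\<^esub>)"
    and observable: "\<And>q. q \<in> primes_of P G \<Longrightarrow> weakly_observable Gs
      (int_sum P {1..} (\<lambda>m. p_socle P q (carrier (subgroup_generated P {if p m = q then w m else \<one>\<^bsub>P\<^esub>}))))"
    and c: "c \<in> cyc_prod {1..} w" "inf_sum {1..} c \<in> fin_supp Gs"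
      "inf_sum {1..} c [^]\<^bsub>P\<^esub> (N::nat) = \<one>\<^bsub>P\<^esub>" "N > 0"
  shows "finite {m \<in> {1..}. c m \<noteq> \<one>\<^bsub>P\<^esub>}"
  using c
proof (induction N arbitrary: c rule: less_induct)
  case (less N)
  note c = less.prems
  have null: "null_family {1..} w"
    using e by (simp add: encodes_def)
  have wG: "w m \<in> G \<inter> fin_supp Gs" if "m \<ge> 1" for m
    using e that by (auto simp: encodes_def)
  have wc: "w m \<in> carrier P" if "m \<ge> 1" for m
    using wG[OF that] G_carrier by blast
  have gc: "w \<in> {1..} \<rightarrow> carrier P" using wc by auto
  have inj: "inj_on (inf_sum {1..}) (cyc_prod {1..} w)"
    and onto: "\<And>x. x \<in> cyc_prod {1..} w \<Longrightarrow> inf_sum {1..} x \<in> G"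
    using e by (auto simp: encodes_def bij_betw_def)
  show ?case
  proof (cases "N = 1")
    case True
    have "inf_sum {1..} c \<in> carrier P"
      using onto[OF c(1)] G_carrier by blast
    then have "inf_sum {1..} c = \<one>\<^bsub>P\<^esub>"
      using c(3) True by simp
    then have "c m = \<one>\<^bsub>P\<^esub>" if "m \<in> {1..}" for m
      using encodes_kernel[OF e c(1) _ that] by blast
    then have "{m \<in> {1..}. c m \<noteq> \<one>\<^bsub>P\<^esub>} = {}"
      by blast
    then show ?thesis by (simp only: finite.emptyI)
  next
    case False
    then obtain q where q: "Factorial_Ring.prime q" "q dvd N"
      using prime_factor_nat by blast
    then obtain N' where N': "N = N' * q" by (metis dvd_def mult.commute)
    then have less: "N' < N" "N' > 0"
      using c(4) prime_gt_1_nat[OF q(1)] by auto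
    define d where "d = (\<lambda>m\<in>{1..}. c m [^]\<^bsub>P\<^esub> N')"
    have d: "d \<in> cyc_prod {1..} w"
      unfolding d_def by (rule cyc_prod_pow[OF gc c(1)])
    have dcyc: "d m \<in> generate P {w m}" if "m \<ge> 1" for m
      using PiE_mem[OF d, of m] that by simp
    have dc: "d \<in> {1..} \<rightarrow> carrier P" by (rule cyc_prod_funcset[OF gc d])
    define u where "u = inf_sum {1..} d"
    have u: "u = inf_sum {1..} c [^]\<^bsub>P\<^esub> N'"
      unfolding u_def d_def by (rule inf_sum_cyc_pow[OF null c(1)])
    have u_fin: "u \<in> fin_supp Gs"
      unfolding u by (rule P.subgroup_nat_pow_closed[OF subgroup_fin_supp c(2)])
    have cc: "inf_sum {1..} c \<in> carrier P"
      using onto[OF c(1)] G_carrier by blast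
    \<comment> \<open>The \<open>q\<close>-th power of \<open>u\<close> is an \<open>N\<close>-th
      power and vanishes; by injectivity it vanishes coefficient by coefficient, so all
      \<open>d m\<close> lie in \<open>q\<close>-socles.\<close>
    have dq: "d m [^]\<^bsub>P\<^esub> q = \<one>\<^bsub>P\<^esub>" if m: "m \<ge> 1" for m
    proof -
      have "inf_sum {1..} (\<lambda>m\<in>{1..}. d m [^]\<^bsub>P\<^esub> q) = u [^]\<^bsub>P\<^esub> q"
        unfolding u_def by (rule inf_sum_cyc_pow[OF null d])
      also have "\<dots> = \<one>\<^bsub>P\<^esub>"
        unfolding u using cc c(3) N' by (simp add: P.nat_pow_pow)
      finally have "(\<lambda>m\<in>{1..}. d m [^]\<^bsub>P\<^esub> q) m = \<one>\<^bsub>P\<^esub>"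
        by (rule encodes_kernel[OF e cyc_prod_pow[OF gc d]]) (use m in simp)
      then show ?thesis
        using m by simp
    qed
    have d_other: "d m = \<one>\<^bsub>P\<^esub>" if m: "m \<ge> 1" "p m \<noteq> q" for m
    proof -
      obtain k where k: "w m [^]\<^bsub>P\<^esub> (p m ^ k) = \<one>\<^bsub>P\<^esub>" using prime[OF m(1)] by blast
      have dm: "d m \<in> carrier P" using dc m(1) by auto
      have "d m [^]\<^bsub>P\<^esub> (p m ^ k) = \<one>\<^bsub>P\<^esub>"
        by (rule cyclic_pow_one[OF wc[OF m(1)] dcyc[OF m(1)] k])
      then have "d m [^]\<^bsub>P\<^esub> int (p m ^ k) \<in> {\<one>\<^bsub>P\<^esub>}" "d m [^]\<^bsub>P\<^esub> int q \<in> {\<one>\<^bsub>P\<^esub>}"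
        using dq[OF m(1)] by (simp_all add: int_pow_int del: of_nat_power)
      moreover have "coprime (int (p m ^ k)) (int q)"
        using prime[OF m(1)] q(1) m(2) by (simp add: primes_coprime)
      ultimately show ?thesis
        using P.subgroup_coprime_pow[OF P.triv_subgroup dm] by blast
    qed
    have fin_d: "finite {m \<in> {1..}. d m \<noteq> \<one>\<^bsub>P\<^esub>}"
    proof (cases "q \<in> primes_of P G")
      \<comment> \<open>\<open>observable\<close> covers the primes of \<open>G\<close> only. For
        any other \<open>q\<close>, a nontrivial \<open>d m\<close> would be an element of order
        \<open>q\<close> in \<open>G\<close>.\<close>
      case False
      have "d m = \<one>\<^bsub>P\<^esub>" if m: "m \<ge> 1" for m
      proof (rule ccontr)
        assume ne: "d m \<noteq> \<one>\<^bsub>P\<^esub>"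
        have "generate P {w m} \<subseteq> G"
          using wG[OF m] by (intro P.generate_subgroup_incl subgroup_G) simp
        then have "d m \<in> G" using dcyc[OF m] by blast
        then have "q \<in> primes_of P G"
          using ne q(1) by (rule primes_ofI[where e = 1]) (simp add: dq[OF m])
        then show False using False by blast
      qed
      then have "{m \<in> {1..}. d m \<noteq> \<one>\<^bsub>P\<^esub>} = {}" by auto
      then show ?thesis by (simp only: finite.emptyI)
    next
      case True
      define B where "B m = p_socle P q (carrier (subgroup_generated P {if p m = q then w m else \<one>\<^bsub>P\<^esub>}))" for m
      have B_eq: "B m = {a \<in> generate P {if p m = q then w m else \<one>\<^bsub>P\<^esub>}. a [^]\<^bsub>P\<^esub> q = \<one>\<^bsub>P\<^esub>}"
        if "m \<ge> 1" for m
        unfolding B_def p_socle_def using wc[OF that] by (simp add: carrier_cyclic)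
      have Bw: "B m \<subseteq> generate P {w m}" if m: "m \<ge> 1" for m
        using B_eq[OF m] P.generate_one generate.one[of P "{w m}"] by (auto split: if_splits)
      have Bc: "B m \<subseteq> carrier P" if "m \<ge> 1" for m
        using Bw[OF that] generate_carrier[of w m] wc[OF that] by blast
      have dB: "d m \<in> carrier (subgroup_generated P (B m))" if m: "m \<ge> 1" for m
      proof (cases "p m = q")
        case True
        then have "d m \<in> B m"
          using B_eq[OF m] dcyc[OF m] dq[OF m] by simp
        then show ?thesis
          using P.subgroup_generated_subset_carrier_subset[OF Bc[OF m]] by blast
      next
        case False
        then show ?thesis
          using d_other[OF m] subgroup.one_closed[OF P.subgroup_subgroup_generated] by simp
      qed
      define H where "H = int_sum P {1..} B"
      have "u \<in> prod_top Gs closure_of H"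
        unfolding in_closure_prod_top
      proof (intro conjI allI)
        show "u \<in> carrier P"
          using u_fin by (simp add: fin_supp_def)
        fix i
        let ?F = "{m \<in> {1..}. \<not> agree i (d m) \<one>\<^bsub>P\<^esub>}"
        \<comment> \<open>Keeping the coefficients that are nontrivial up to \<open>i\<close> gives
          an element of \<open>H\<close> that agrees with \<open>u\<close> up to
          \<open>i\<close>.\<close>
        let ?d = "\<lambda>m\<in>{1..}. if m \<in> ?F then d m else \<one>\<^bsub>P\<^esub>"
        have finF: "finite ?F"
          using null_family_cyc_prod[OF null d] by (simp add: null_family_def)
        have d': "?d \<in> cyc_prod {1..} w" by (rule cyc_prod_cut[OF d])
        have dc': "?d \<in> {1..} \<rightarrow> carrier P" by (rule cyc_prod_funcset[OF gc d'])
        have fin': "finite {m \<in> {1..}. ?d m \<noteq> \<one>\<^bsub>P\<^esub>}"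
          by (rule finite_subset[OF _ finF]) auto
        have "?d m \<in> carrier (subgroup_generated P (B m))" if "m \<in> {1..}" for m
          using dB[of m] that subgroup.one_closed[OF P.subgroup_subgroup_generated] by simp
        then have "?d \<in> ext_sum P {1..} B"
          unfolding ext_sum_iff using fin' by (intro conjI PiE_I) auto
        then have "inf_sum {1..} ?d \<in> H"
          unfolding H_def int_sum_def using inf_sum_eq_gfinprod[OF dc' fin'] by (intro image_eqI)
        moreover have "inf_sum {1..} ?d \<in> carrier P"
          by (rule inf_sum_closed[OF dc'])
        moreover have "agree i (inf_sum {1..} ?d) u"
        proof -
          have "agree i (inf_sum {1..} d) (finprod P d ?F)"
            by (rule agree_inf_sum[OF dc finF]) auto
          moreover have "agree i (inf_sum {1..} ?d) (finprod P ?d ?F)"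
            by (rule agree_inf_sum[OF dc' finF]) (auto simp: agree_def)
          moreover have "finprod P ?d ?F = finprod P d ?F"
            using dc by (intro P.finprod_cong') auto
          ultimately show ?thesis by (simp add: agree_def u_def)
        qed
        ultimately show "\<exists>s\<in>H \<inter> carrier P. agree i s u" by blast
      qed
      then have "u \<in> H"
        using observable[OF True] u_fin unfolding weakly_observable_def H_def B_def by blast
      then obtain b where b: "b \<in> ext_sum P {1..} B" "u = gfinprod P b {1..}"
        unfolding H_def int_sum_def by blast
      have bw: "b m \<in> generate P {w m}" if m: "m \<ge> 1" for m
      proof -
        have "carrier (subgroup_generated P (B m)) \<subseteq> generate P {w m}"
          by (rule P.subgroup_generated_minimal[OF subgroup_cyclic[OF wc[OF m]] Bw[OF m]])
        then show ?thesis using b(1) m unfolding ext_sum_iff by auto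
      qed
      then have bC: "b \<in> cyc_prod {1..} w"
        using b(1) unfolding ext_sum_iff by (auto simp: PiE_iff)
      have "inf_sum {1..} b = gfinprod P b {1..}"
        using b(1) by (intro inf_sum_eq_gfinprod cyc_prod_funcset[OF gc bC]) (simp add: ext_sum_iff)
      then have "b = d"
        using inj_onD[OF inj _ bC d] b(2) by (simp add: u_def)
      then show ?thesis
        using b(1) by (simp add: ext_sum_iff)
    qed
    \<comment> \<open>\<open>c\<close> is divided into the finitely many coefficients with
      nontrivial \<open>N'\<close>-th power and the rest \<open>c2\<close>. The sum of
      \<open>c2\<close> still has finite support, and its \<open>N'\<close>-th power is trivial, so
      the induction hypothesis applies.\<close>
    define F where "F = {m \<in> {1..}. d m \<noteq> \<one>\<^bsub>P\<^esub>}"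
    define c1 where "c1 = (\<lambda>m\<in>{1..}. if m \<in> F then c m else \<one>\<^bsub>P\<^esub>)"
    define c2 where "c2 = (\<lambda>m\<in>{1..}. if m \<in> - F then c m else \<one>\<^bsub>P\<^esub>)"
    have c12: "c1 \<in> cyc_prod {1..} w" "c2 \<in> cyc_prod {1..} w"
      unfolding c1_def c2_def by (rule cyc_prod_cut[OF c(1)])+
    have ccm: "c m \<in> carrier P" if "m \<in> {1..}" for m
      using cyc_prod_funcset[OF gc c(1)] that by auto
    have "(\<lambda>m\<in>{1..}. c2 m \<otimes>\<^bsub>P\<^esub> c1 m) = c"
      by (rule PiE_ext[OF cyc_prod_mult(1)[OF gc c12(2,1)] c(1)]) (use ccm in \<open>auto simp: c1_def c2_def\<close>)
    then have prod: "inf_sum {1..} c = inf_sum {1..} c2 \<otimes>\<^bsub>P\<^esub> inf_sum {1..} c1"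
      using inf_sum_cyc_mult[OF null c12(2,1)] by simp
    have c1_fin: "inf_sum {1..} c1 \<in> fin_supp Gs"
    proof -
      have cut: "finite {m \<in> {1..}. c1 m \<noteq> \<one>\<^bsub>P\<^esub>}"
        by (rule finite_subset[OF _ fin_d[folded F_def]]) (auto simp: c1_def)
      have "c1 m \<in> fin_supp Gs" if m: "m \<in> {1..}" for m
      proof -
        have "generate P {w m} \<subseteq> fin_supp Gs"
          using wG[of m] m by (intro P.generate_subgroup_incl subgroup_fin_supp) simp
        then show ?thesis using PiE_mem[OF c12(1) m] by blast
      qed
      then have "gfinprod P c1 {1..} \<in> fin_supp Gs"
        by (intro gfinprod_in_subgroup[OF subgroup_fin_supp]) auto
      then show ?thesis
        using inf_sum_eq_gfinprod[OF cyc_prod_funcset[OF gc c12(1)] cut] by simp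
    qed
    have carr: "inf_sum {1..} c1 \<in> carrier P" "inf_sum {1..} c2 \<in> carrier P"
      using onto c12 G_carrier by blast+
    have "inf_sum {1..} c2 = inf_sum {1..} c \<otimes>\<^bsub>P\<^esub> inv\<^bsub>P\<^esub> inf_sum {1..} c1"
      using prod carr by (simp add: P.m_assoc)
    then have c2_fin: "inf_sum {1..} c2 \<in> fin_supp Gs"
      using c(2) c1_fin subgroup.m_closed[OF subgroup_fin_supp] subgroup.m_inv_closed[OF subgroup_fin_supp]
      by simp
    have c2_pow: "(\<lambda>m\<in>{1..}. c2 m [^]\<^bsub>P\<^esub> N') = (\<lambda>m\<in>{1..}. \<one>\<^bsub>P\<^esub>)"
      by (rule restrict_ext) (auto simp: c2_def F_def d_def)
    have "inf_sum {1..} c2 [^]\<^bsub>P\<^esub> N' = \<one>\<^bsub>P\<^esub>"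
      unfolding inf_sum_cyc_pow[OF null c12(2), symmetric] c2_pow by (rule inf_sum_one)
    then have "finite {m \<in> {1..}. c2 m \<noteq> \<one>\<^bsub>P\<^esub>}"
      using less.IH[OF less(1) c12(2) c2_fin _ less(2)] by blast
    moreover have "{m \<in> {1..}. c m \<noteq> \<one>\<^bsub>P\<^esub>} \<subseteq> F \<union> {m \<in> {1..}. c2 m \<noteq> \<one>\<^bsub>P\<^esub>}"
      by (auto simp: c2_def)
    ultimately show ?thesis
      using fin_d[folded F_def] by (meson finite_UnI finite_subset)
  qed
qed

text \<open>Finite sums have finite support because every generator has; the converse is what
  \<open>fin\<close> supplies.\<close>

lemma encodes_implicit_direct_product:
  fixes w :: "nat \<Rightarrow> nat \<Rightarrow> 'a"
  assumes e: "encodes {1..} w"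
    and fin: "\<And>c. c \<in> cyc_prod {1..} w \<Longrightarrow> inf_sum {1..} c \<in> fin_supp Gs \<Longrightarrow>
      finite {m \<in> {1..}. c m \<noteq> \<one>\<^bsub>P\<^esub>}"
  shows "implicit_direct_product Gs G"
  unfolding implicit_direct_product_def
proof (intro exI conjI)
  show "isomorphic_encoder Gs G {1..} w (inf_sum {1..})"
    by (rule encodes_isomorphic_encoder[OF e]) simp
  have gc: "w \<in> {1..} \<rightarrow> carrier P" using e by (rule encodes_funcset)
  have bij: "inf_sum {1..} ` cyc_prod {1..} w = G"
    using e by (simp add: encodes_def bij_betw_def)
  have "inf_sum {1..} x \<in> fin_supp Gs" if x: "x \<in> ext_sum P {1..} (\<lambda>n. {w n})" for x
  proof -
    have x': "x \<in> cyc_prod {1..} w" "finite {n \<in> {1..}. x n \<noteq> \<one>\<^bsub>P\<^esub>}"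
      using x unfolding ext_sum_cyclic[OF gc] by auto
    have "x m \<in> fin_supp Gs" if m: "m \<in> {1..}" for m
    proof -
      have "generate P {w m} \<subseteq> fin_supp Gs"
        using e m by (intro P.generate_subgroup_incl subgroup_fin_supp) (auto simp: encodes_def)
      then show ?thesis using PiE_mem[OF x'(1) m] by blast
    qed
    then have "gfinprod P x {1..} \<in> fin_supp Gs"
      by (intro gfinprod_in_subgroup[OF subgroup_fin_supp]) auto
    then show ?thesis
      using inf_sum_eq_gfinprod[OF cyc_prod_funcset[OF gc x'(1)] x'(2)] by simp
  qed
  moreover have "inf_sum {1..} ` ext_sum P {1..} (\<lambda>n. {w n}) \<subseteq> G"
    using bij unfolding ext_sum_cyclic[OF gc] by blast
  moreover have "G \<inter> fin_supp Gs \<subseteq> inf_sum {1..} ` ext_sum P {1..} (\<lambda>n. {w n})"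
  proof
    fix c assume c: "c \<in> G \<inter> fin_supp Gs"
    then obtain x where x: "x \<in> cyc_prod {1..} w" "c = inf_sum {1..} x"
      using bij by blast
    then have "x \<in> ext_sum P {1..} (\<lambda>n. {w n})"
      using fin[OF x(1)] c unfolding ext_sum_cyclic[OF gc] by blast
    then show "c \<in> inf_sum {1..} ` ext_sum P {1..} (\<lambda>n. {w n})"
      using x(2) by blast
  qed
  ultimately show "inf_sum {1..} ` ext_sum P {1..} (\<lambda>n. {w n}) = G \<inter> fin_supp Gs"
    by blast
qed

lemma ex_encoding_sequence:
  "\<exists>p w. encodes {1::nat..} w \<and>
     (\<forall>m\<ge>1. Factorial_Ring.prime (p m) \<and> (\<exists>e. w m [^]\<^bsub>P\<^esub> ((p m :: nat) ^ e) = \<one>\<^bsub>P\<^esub>))"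
proof (rule splitting_sequence)
  fix R p w
  assume R: "R 1 = G" "\<And>m. m \<ge> 1 \<Longrightarrow> open_subgroup (R m)"
    and split: "\<And>m. m \<ge> 1 \<Longrightarrow> cyclic_split (R m) (p m) (w m) (R (Suc m))"
    and conv: "\<And>m n. 1 \<le> m \<Longrightarrow> m \<le> n \<Longrightarrow> R n \<subseteq> R m" "\<And>i. \<exists>m\<ge>1. R m \<subseteq> tail i"
  have "encodes {1..} w"
    by (rule splitting_sequence_encodes[OF R split conv])
  moreover have "\<forall>m\<ge>1. Factorial_Ring.prime (p m) \<and> (\<exists>e. w m [^]\<^bsub>P\<^esub> (p m ^ e) = \<one>\<^bsub>P\<^esub>)"
    using split unfolding cyclic_split_def by auto
  ultimately show ?thesis by blast
qed

text \<open>The splittings attach one prime to each index, whereas the family of the theorem has an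
  entry for each index and each prime. The generator goes to the entry of its own prime and
  \<open>\<one>\<close> to the others. Only nontrivial generators need a prime in \<open>Q\<close>,
  since a trivial one may carry a prime foreign to \<open>G\<close>.\<close>

lemma encodes_split_by:
  fixes p :: "nat \<Rightarrow> nat" and w :: "nat \<Rightarrow> nat \<Rightarrow> 'a"
  assumes e: "encodes {1..} w" and p: "\<And>m. m \<ge> 1 \<Longrightarrow> w m \<noteq> \<one>\<^bsub>P\<^esub> \<Longrightarrow> p m \<in> Q"
  shows "encodes ({1..} \<times> Q) (\<lambda>(m, q). if p m = q then w m else \<one>\<^bsub>P\<^esub>)"
proof (rule encodes_reindex[OF e, where \<psi> = "\<lambda>m. (m, p m)", of "{m \<in> {1..}. w m \<noteq> \<one>\<^bsub>P\<^esub>}"])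
  show "(case mq of (m, q) \<Rightarrow> if p m = q then w m else \<one>\<^bsub>P\<^esub>) = \<one>\<^bsub>P\<^esub>"
    if "mq \<in> {1..} \<times> Q - (\<lambda>m. (m, p m)) ` {m \<in> {1..}. w m \<noteq> \<one>\<^bsub>P\<^esub>}" for mq
    using that by auto
qed (use p in \<open>auto simp: inj_on_def\<close>)

end

section \<open>Order controllable groups\<close>

theorem theorem1:
  fixes Gs :: "nat \<Rightarrow> ('a, 'b) monoid_scheme" and G :: "(nat \<Rightarrow> 'a) set"
  assumes "\<And>i. i \<ge> 1 \<Longrightarrow> comm_group (Gs i)"
    and "\<And>i. i \<ge> 1 \<Longrightarrow> finite (carrier (Gs i))"
    and "subgroup G (prod_grp Gs)"
    and "closedin (prod_top Gs) G"
    and "order_controllable Gs G"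
  shows "\<exists>y :: nat \<Rightarrow> nat \<Rightarrow> nat \<Rightarrow> 'a.
    (\<forall>m\<in>{1..}. \<forall>p\<in>primes_of (prod_grp Gs) G. y m p \<in> G \<inter> fin_supp Gs) \<and>
    (generating_set Gs G ({1..} \<times> primes_of (prod_grp Gs) G) (\<lambda>(m, p). y m p) \<and>
     (\<forall>p\<in>primes_of (prod_grp Gs) G.
        {y m p | m. m \<in> {1..}} \<subseteq> p_part (prod_grp Gs) p (G \<inter> fin_supp Gs))) \<and>
    (finite_exponent (prod_grp Gs) G \<longrightarrow>
       (\<exists>\<Phi>. isomorphic_encoder Gs G ({1..} \<times> primes_of (prod_grp Gs) G) (\<lambda>(m, p). y m p) \<Phi>) \<and>
       weakly_rectangular Gs G) \<and>
    ((\<forall>p\<in>primes_of (prod_grp Gs) G.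
        weakly_observable Gs
          (int_sum (prod_grp Gs) {1..}
             (\<lambda>m. p_socle (prod_grp Gs) p
                (carrier (subgroup_generated (prod_grp Gs) {y m p}))))) \<longrightarrow>
     implicit_direct_product Gs G)"
proof -
  interpret controllable_group Gs G
    by (intro controllable_group.intro finite_comm_groups.intro controllable_group_axioms.intro assms)
  obtain p w where e: "encodes {1::nat..} w"
    and pw: "\<forall>m\<ge>1. Factorial_Ring.prime (p m) \<and> (\<exists>e. w m [^]\<^bsub>P\<^esub> ((p m :: nat) ^ e) = \<one>\<^bsub>P\<^esub>)"
    using ex_encoding_sequence by blast
  have prime_p: "Factorial_Ring.prime (p m)" and w: "w m \<in> G \<inter> fin_supp Gs"
    and tors: "\<exists>e. w m [^]\<^bsub>P\<^esub> (p m ^ e) = \<one>\<^bsub>P\<^esub>" if "m \<ge> 1" for m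
    using pw e that by (auto simp: encodes_def)
  have p_primes: "p m \<in> primes_of P G" if m: "m \<ge> 1" "w m \<noteq> \<one>\<^bsub>P\<^esub>" for m
  proof -
    obtain e where "w m [^]\<^bsub>P\<^esub> (p m ^ e) = \<one>\<^bsub>P\<^esub>"
      using tors[OF m(1)] by blast
    then show ?thesis
      using primes_ofI[OF _ m(2) prime_p[OF m(1)]] w[OF m(1)] by simp
  qed
  \<comment> \<open>Filling the entries of foreign primes with \<open>\<one>\<close> gives
    \<open>y m q\<close> an order that is a power of \<open>q\<close> in every case.\<close>
  define y where "y m q = (if p m = q then w m else \<one>\<^bsub>P\<^esub>)" for m q
  let ?L = "{1::nat..} \<times> primes_of P G"
  let ?y = "\<lambda>(m, q). y m q"
  have y: "y m q \<in> G \<inter> fin_supp Gs" if "m \<ge> 1" for m q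
    unfolding y_def using w[OF that] subgroup.one_closed[OF subgroup_G]
      subgroup.one_closed[OF subgroup_fin_supp] by simp
  have L: "countable ?L"
    by (rule countableI_type)
  have ey: "encodes ?L ?y"
    unfolding y_def by (rule encodes_split_by[OF e p_primes])
  have part_p: "y m q \<in> p_part P q (G \<inter> fin_supp Gs)" if m: "m \<ge> 1" and q: "q \<in> primes_of P G" for m q
  proof -
    have q': "Factorial_Ring.prime q" using q by (simp add: primes_of_def)
    obtain e where "y m q [^]\<^bsub>P\<^esub> (q ^ e) = \<one>\<^bsub>P\<^esub>"
      using tors[OF m] unfolding y_def by (cases "p m = q") auto
    then have "\<exists>k. group.ord P (y m q) = q ^ k"
      using ord_prime_power[OF _ q'] y[OF m] G_carrier by blast
    then show ?thesis
      using y[OF m] by (simp add: p_part_def)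
  qed
  have implicit: "implicit_direct_product Gs G"
    if ob: "\<forall>q\<in>primes_of P G. weakly_observable Gs
      (int_sum P {1..} (\<lambda>m. p_socle P q (carrier (subgroup_generated P {y m q}))))"
  \<comment> \<open>\<open>implicit_direct_product\<close> asks for natural numbers as indices, so
    the sequence \<open>w\<close> is used as generating set; the assumption on \<open>y\<close> is,
    after unfolding, the one that \<open>encodes_finite_support\<close> makes about
    \<open>w\<close>.\<close>
  proof (rule encodes_implicit_direct_product[OF e])
    fix c assume c: "c \<in> cyc_prod {1..} w" "inf_sum {1..} c \<in> fin_supp Gs"
    obtain N :: nat where N: "N > 0" "inf_sum {1..} c [^]\<^bsub>P\<^esub> N = \<one>\<^bsub>P\<^esub>"
      using fin_supp_torsion[OF c(2)] by blast
    show "finite {m \<in> {1..}. c m \<noteq> \<one>\<^bsub>P\<^esub>}"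
      by (rule encodes_finite_support[where p = p, OF e _ _ c N(2,1)])
        (use prime_p tors ob[unfolded y_def] in auto)
  qed
  have encoder: "\<exists>\<Phi>. isomorphic_encoder Gs G ?L ?y \<Phi>"
    using encodes_isomorphic_encoder[OF ey L] by blast
  \<comment> \<open>Here too the encoder comes from the sequence \<open>w\<close>, whose index set
    consists of natural numbers.\<close>
  have "weakly_rectangular Gs G"
    unfolding weakly_rectangular_def using encodes_isomorphic_encoder[OF e] by blast
  then show ?thesis
    using y part_p implicit encoder encodes_generating_set[OF ey L] by (intro exI[of _ y]) auto
qed

end
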